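(* Let $(W,S)$ be a Coxeter system. (i) Let $(Q,\phi)$ be a maximal distinguished matching on $W$ and $a=\phi(e)\in S$. For every $s\in S\setminus\{a\}$, $P_s=\langle s,a\rangle$ is contained in $Q$ and stable under $\phi$, so that $\phi$ induces a matching $\phi_s$ on $P_s$. (ii) Conversely, let $a\in S$ and for each $s\in S\setminus\{a\}$ let $\alpha_s$ be a distinguished matching on $P_s=\langle s,a\rangle$ (with domain all of $P_s$) such that $\alpha_s(e)=a$. Then there is a unique maximal distinguished matching $\phi$ on $W$ which extends the union of the $\alpha_s$: $\phi|_{P_s}=\alpha_s$ for all $s\in S\setminus\{a\}$.
   Context: $W$ carries the Bruhat order $\le$ and the length function; $e$ is the identity; $x\lhd y$ means that $y$ covers $x$; $\mathrm{coat}(y)=\{x : x\lhd y\}$. A subset $Q\subseteq W$ is decreasing if $q\in Q$ and $x\le q$ imply $x\in Q$. A partial distinguished matching of $W$ is a pair $(Q,\phi)$ with $Q\subseteq W$ decreasing and $\phi:Q\to Q$ such that: (i) $\phi(\phi(u))=u$ for all $u$; (ii) for all $u\in Q$, $u\lhd\phi(u)$ or $\phi(u)\lhd u$; (iii) for all $u\in Q$ with $u\lhd\phi(u)$, $\mathrm{coat}(\phi(u))=\{u\}\cup\{\phi(v): v\lhd u,\ v\lhd\phi(v)\}$. It is maximal if it is maximal for the order: $(Q_1,\phi_1)\le(Q_2,\phi_2)$ iff $Q_1\subseteq Q_2$ and $\phi_2$ extends $\phi_1$. A distinguished matching on a decreasing subset $A\subseteq W$ is a map $A\to A$ such that $(A,\cdot)$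 is a partial distinguished matching. If $Q\ne\emptyset$ then $e\in Q$ and $\phi(e)\in S$. *)

theory Defs
  imports "HOL-Algebra.Algebra"
begin

definition word_prod :: "('a, 'b) monoid_scheme \<Rightarrow> 'a list \<Rightarrow> 'a" where
  "word_prod G ws = foldr (\<lambda>x y. x \<otimes>\<^bsub>G\<^esub> y) ws \<one>\<^bsub>G\<^esub>"

text \<open>
  The congruence on the free monoid on \<open>S\<close> generated by the Coxeter relators \<open>(s t)\<^sup>m\<close>, where
  \<open>m\<close> is the order of \<open>s t\<close> in \<open>G\<close>. The library's \<^const>\<open>group.ord\<close> is \<open>0\<close> for elements of
  infinite order, and then there is no relation. For \<open>s = t\<close> the order is \<open>1\<close> and the relator is
  \<open>s s\<close>; so letters are self-inverse modulo the congruence, and the quotient monoid is the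
  group presented by these generators and relations.
\<close>
inductive coxeter_equiv :: "('a, 'b) monoid_scheme \<Rightarrow> 'a set \<Rightarrow> 'a list \<Rightarrow> 'a list \<Rightarrow> bool"
  for G :: "('a, 'b) monoid_scheme" and S :: "'a set" where
  relator: "\<lbrakk>xs \<in> lists S; ys \<in> lists S; s \<in> S; t \<in> S; group.ord G (s \<otimes>\<^bsub>G\<^esub> t) > 0\<rbrakk> \<Longrightarrow>
    coxeter_equiv G S (xs @ concat (replicate (group.ord G (s \<otimes>\<^bsub>G\<^esub> t)) [s, t]) @ ys) (xs @ ys)"
| refl: "xs \<in> lists S \<Longrightarrow> coxeter_equiv G S xs xs"
| sym: "coxeter_equiv G S xs ys \<Longrightarrow> coxeter_equiv G S ys xs"
| trans: "\<lbrakk>coxeter_equiv G S xs ys; coxeter_equiv G S ys zs\<rbrakk> \<Longrightarrow> coxeter_equiv G S xs zs"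

text \<open>
  Coxeter systems in the sense of Bourbaki: \<open>S\<close> consists of elements of order 2, generates \<open>W\<close>,
  and together with the relations \<open>(s t)\<^sup>m = 1\<close>, where \<open>m\<close> is the order of \<open>s t\<close> whenever it is
  finite, it is a presentation of \<open>W\<close>. The set \<open>S\<close> may be infinite.
\<close>
locale coxeter_system = group W
  for W :: "('a, 'b) monoid_scheme" (structure) +
  fixes S :: "'a set"
  assumes gens_closed: "S \<subseteq> carrier W"
    and gens_generate: "generate W S = carrier W"
    and gens_order: "\<And>s. s \<in> S \<Longrightarrow> ord s = 2"
    and presentation: "\<And>xs ys. \<lbrakk>xs \<in> lists S; ys \<in> lists S; word_prod W xs = word_prod W ys\<rbrakk> \<Longrightarrow>
      coxeter_equiv W S xs ys"
begin

definition cox_length :: "'a \<Rightarrow> nat" where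
  "cox_length w = (LEAST n. \<exists>ws \<in> lists S. length ws = n \<and> word_prod W ws = w)"

definition reflections :: "'a set" where
  "reflections = {w \<otimes> s \<otimes> inv w | w s. w \<in> carrier W \<and> s \<in> S}"

definition bruhat_step :: "'a \<Rightarrow> 'a \<Rightarrow> bool" where
  "bruhat_step x y \<longleftrightarrow> x \<in> carrier W \<and>
    (\<exists>t \<in> reflections. y = x \<otimes> t \<and> cox_length x < cox_length y)"

definition bruhat_le :: "'a \<Rightarrow> 'a \<Rightarrow> bool" where
  "bruhat_le x y \<longleftrightarrow> x \<in> carrier W \<and> bruhat_step\<^sup>*\<^sup>* x y"

definition bruhat_less :: "'a \<Rightarrow> 'a \<Rightarrow> bool" where
  "bruhat_less x y \<longleftrightarrow> bruhat_le x y \<and> x \<noteq> y"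

definition covered_by :: "'a \<Rightarrow> 'a \<Rightarrow> bool" where
  "covered_by x y \<longleftrightarrow> bruhat_less x y \<and> \<not> (\<exists>z. bruhat_less x z \<and> bruhat_less z y)"

definition coat :: "'a \<Rightarrow> 'a set" where
  "coat y = {x. covered_by x y}"

definition decreasing :: "'a set \<Rightarrow> bool" where
  "decreasing Q \<longleftrightarrow> Q \<subseteq> carrier W \<and> (\<forall>q \<in> Q. \<forall>x. bruhat_le x q \<longrightarrow> x \<in> Q)"

text \<open>
  A map \<open>\<phi> : Q \<rightarrow> Q\<close> is represented by the HOL function that is \<^const>\<open>undefined\<close> outside \<open>Q\<close>,
  so that equality of pairs \<open>(Q, \<phi>)\<close> is equality of partial maps.
\<close>
definition partial_distinguished_matching :: "'a set \<times> ('a \<Rightarrow> 'a) \<Rightarrow> bool" where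
  "partial_distinguished_matching = (\<lambda>(Q, \<phi>).
    decreasing Q \<and> \<phi> \<in> Q \<rightarrow>\<^sub>E Q \<and>
    (\<forall>u \<in> Q. \<phi> (\<phi> u) = u) \<and>
    (\<forall>u \<in> Q. covered_by u (\<phi> u) \<or> covered_by (\<phi> u) u) \<and>
    (\<forall>u \<in> Q. covered_by u (\<phi> u) \<longrightarrow>
      coat (\<phi> u) = {u} \<union> {\<phi> v | v. covered_by v u \<and> covered_by v (\<phi> v)}))"

definition matching_le :: "'a set \<times> ('a \<Rightarrow> 'a) \<Rightarrow> 'a set \<times> ('a \<Rightarrow> 'a) \<Rightarrow> bool" where
  "matching_le M1 M2 \<longleftrightarrow> fst M1 \<subseteq> fst M2 \<and> (\<forall>u \<in> fst M1. snd M2 u = snd M1 u)"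

definition maximal_distinguished_matching :: "'a set \<times> ('a \<Rightarrow> 'a) \<Rightarrow> bool" where
  "maximal_distinguished_matching M \<longleftrightarrow> partial_distinguished_matching M \<and>
    (\<forall>M'. partial_distinguished_matching M' \<and> matching_le M M' \<longrightarrow> M' = M)"

definition distinguished_matching_on :: "'a set \<Rightarrow> ('a \<Rightarrow> 'a) \<Rightarrow> bool" where
  "distinguished_matching_on A \<phi> \<longleftrightarrow> decreasing A \<and> partial_distinguished_matching (A, \<phi>)"

end

end

(*
  A matching is determined by its restrictions to the dihedral subgroups P_s: a matching value
  phi(u) above u has its set of coatoms prescribed by phi on shorter elements, and two distinct
  elements with the same coatoms lie in a common dihedral parabolic subgroup, which must then
  contain a. Hence matchings that agree on all P_s agree wherever both are defined and can be glued,
  which yields a largest matching extending the given ones. Conversely, in P_s the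
  Bruhat order is x < y iff x is shorter than y, so a matching whose domain contains only a part
  of P_s can be extended by one more pair of elements of P_s.
*)
theory Submission
  imports Defs
begin

text \<open>Coatoms and decreasing sets become tractable through the deletion of letters, so
  everything hinges on strong exchange. This has to be extracted from the presentation: the parity
  with which a reflection occurs among the deletion reflections of a word is invariant under the
  relators. The reason why \<open>a\<close> lies in the dihedral subgroup where two matchings could
  part company is that an element of length at least two never has a single coatom. An element
  matched downwards, unless matched with \<open>\<one>\<close>, therefore has a coatom that is again
  matched downwards, and this descent can only stop at \<open>a\<close>, without leaving a parabolic
  subgroup. Since gluing is applied at once to all matchings that extend the
  \<open>\<alpha> s\<close>, no Zorn argument is needed. For \<open>S = {a}\<close> there is no
  \<open>\<alpha> s\<close> at all; the pair of \<open>\<one>\<close> and \<open>a\<close> is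
  therefore carried along as an additional seed.\<close>

context coxeter_system
begin

section \<open>Words in the generators and the length function\<close>

lemma word_prod_simps [simp]:
  "word_prod W [] = \<one>" "word_prod W (x # xs) = x \<otimes> word_prod W xs"
  by (simp_all add: word_prod_def)

lemma word_prod_closed [simp, intro]: "set ws \<subseteq> carrier W \<Longrightarrow> word_prod W ws \<in> carrier W"
  by (induction ws) auto

lemma word_prod_append:
  "set us \<subseteq> carrier W \<Longrightarrow> set vs \<subseteq> carrier W \<Longrightarrow>
    word_prod W (us @ vs) = word_prod W us \<otimes> word_prod W vs"
  by (induction us) (auto simp: m_assoc)

lemma gen_closed [simp]: "s \<in> S \<Longrightarrow> s \<in> carrier W"
  using gens_closed by auto

lemma word_prod_snoc:
  "set us \<subseteq> S \<Longrightarrow> s \<in> S \<Longrightarrow> word_prod W (us @ [s]) = word_prod W us \<otimes> s"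
  using gens_closed by (subst word_prod_append) auto

lemma word_prod_gens [simp]: "set ws \<subseteq> S \<Longrightarrow> word_prod W ws \<in> carrier W"
  using gens_closed by (intro word_prod_closed) auto

lemma gen_square [simp]: "s \<in> S \<Longrightarrow> s \<otimes> s = \<one>"
  using gens_order[of s] pow_ord_eq_1[of s] by (simp add: numeral_2_eq_2)

lemma gen_neq_one: "s \<in> S \<Longrightarrow> s \<noteq> \<one>"
  using gens_order[of s] by auto

lemma gen_inv [simp]: "s \<in> S \<Longrightarrow> inv s = s"
  by (rule inv_equality) auto

lemma gen_cancel_right [simp]: "s \<in> S \<Longrightarrow> w \<in> carrier W \<Longrightarrow> w \<otimes> s \<otimes> s = w"
  by (simp add: m_assoc)

lemma gen_cancel_left [simp]: "s \<in> S \<Longrightarrow> w \<in> carrier W \<Longrightarrow> s \<otimes> (s \<otimes> w) = w"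
  by (simp add: m_assoc[symmetric])

lemma generate_iff_word:
  assumes "J \<subseteq> S"
  shows "w \<in> generate W J \<longleftrightarrow> (\<exists>ws. set ws \<subseteq> J \<and> word_prod W ws = w)"
proof
  assume "w \<in> generate W J"
  then show "\<exists>ws. set ws \<subseteq> J \<and> word_prod W ws = w"
  proof induction
    case one
    show ?case by (intro exI[of _ "[]"]) simp
  next
    case (incl h)
    then show ?case using assms by (intro exI[of _ "[h]"]) auto
  next
    case (inv h)
    then show ?case using assms by (intro exI[of _ "[h]"]) (auto simp: subset_iff)
  next
    case (eng h1 h2)
    then obtain us vs where "set us \<subseteq> J" "word_prod W us = h1" "set vs \<subseteq> J" "word_prod W vs = h2"
      by blast
    moreover from this have "word_prod W (us @ vs) = h1 \<otimes> h2"
      using assms gens_closed by (subst word_prod_append) auto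
    ultimately show ?case by (intro exI[of _ "us @ vs"]) auto
  qed
next
  assume "\<exists>ws. set ws \<subseteq> J \<and> word_prod W ws = w"
  then obtain ws where "set ws \<subseteq> J" and w: "w = word_prod W ws" by blast
  then show "w \<in> generate W J"
    unfolding w by (induction ws) (auto intro: generate.intros)
qed

lemma ex_word: "w \<in> carrier W \<Longrightarrow> \<exists>ws. set ws \<subseteq> S \<and> word_prod W ws = w"
  using generate_iff_word[of S] gens_generate by auto

definition reduced :: "'a list \<Rightarrow> bool" where
  "reduced ws \<longleftrightarrow> set ws \<subseteq> S \<and> length ws = cox_length (word_prod W ws)"

lemma cox_length_le: "set ws \<subseteq> S \<Longrightarrow> cox_length (word_prod W ws) \<le> length ws"
  unfolding cox_length_def by (rule Least_le) (auto simp: lists_eq_set)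

lemma ex_reduced:
  assumes "w \<in> carrier W"
  shows "\<exists>ws. reduced ws \<and> word_prod W ws = w"
proof -
  let ?P = "\<lambda>n. \<exists>ws \<in> lists S. length ws = n \<and> word_prod W ws = w"
  obtain ws where "set ws \<subseteq> S" "word_prod W ws = w" using ex_word[OF assms] by blast
  then have "?P (length ws)" by (auto simp: lists_eq_set)
  then have "?P (cox_length w)" unfolding cox_length_def by (rule LeastI)
  then show ?thesis by (auto simp: lists_eq_set reduced_def)
qed

lemma reducedI: "set ws \<subseteq> S \<Longrightarrow> length ws \<le> cox_length (word_prod W ws) \<Longrightarrow> reduced ws"
  using cox_length_le[of ws] by (simp add: reduced_def)

lemma cox_length_one [simp]: "cox_length \<one> = 0"
  using cox_length_le[of "[]"] by simp

lemma cox_length_eq_0: "w \<in> carrier W \<Longrightarrow> cox_length w = 0 \<longleftrightarrow> w = \<one>"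
  using ex_reduced[of w] by (auto simp: reduced_def)

lemma cox_length_mult_le:
  assumes "x \<in> carrier W" "y \<in> carrier W"
  shows "cox_length (x \<otimes> y) \<le> cox_length x + cox_length y"
proof -
  obtain us vs where r: "reduced us" "word_prod W us = x" "reduced vs" "word_prod W vs = y"
    using ex_reduced assms by metis
  then have "word_prod W (us @ vs) = x \<otimes> y"
    using gens_closed by (subst word_prod_append) (auto simp: reduced_def)
  with r show ?thesis using cox_length_le[of "us @ vs"] by (auto simp: reduced_def)
qed

lemma cox_length_gen: "s \<in> S \<Longrightarrow> cox_length s = 1"
  using cox_length_le[of "[s]"] cox_length_eq_0[of s] gen_neq_one[of s] by (cases "cox_length s") auto

lemma gen_if_cox_length_1:
  assumes "w \<in> carrier W" "cox_length w = 1"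
  shows "w \<in> S"
proof -
  obtain ws where "reduced ws" "word_prod W ws = w" using ex_reduced assms(1) by blast
  then show ?thesis using assms by (cases ws) (auto simp: reduced_def)
qed

lemma reduced_append:
  assumes "reduced (us @ vs)"
  shows "reduced us" "reduced vs"
proof -
  have S: "set us \<subseteq> S" "set vs \<subseteq> S" using assms by (auto simp: reduced_def)
  have "length us + length vs = cox_length (word_prod W us \<otimes> word_prod W vs)"
    using assms S gens_closed by (auto simp: reduced_def word_prod_append)
  also have "\<dots> \<le> cox_length (word_prod W us) + cox_length (word_prod W vs)"
    using S by (intro cox_length_mult_le) auto
  finally show "reduced us" "reduced vs"
    using cox_length_le[OF S(1)] cox_length_le[OF S(2)] S by (auto simp: reduced_def)
qed

section \<open>Strong exchange\<close>

definition conjg :: "'a \<Rightarrow> 'a \<Rightarrow> 'a" where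
  "conjg x r = inv x \<otimes> r \<otimes> x"

lemma conjg_closed [simp]: "x \<in> carrier W \<Longrightarrow> r \<in> carrier W \<Longrightarrow> conjg x r \<in> carrier W"
  by (simp add: conjg_def)

lemma conjg_one [simp]: "r \<in> carrier W \<Longrightarrow> conjg \<one> r = r"
  by (simp add: conjg_def)

lemma conjg_mult:
  "x \<in> carrier W \<Longrightarrow> y \<in> carrier W \<Longrightarrow> r \<in> carrier W \<Longrightarrow> conjg (x \<otimes> y) r = conjg y (conjg x r)"
  by (simp add: conjg_def inv_mult_group m_assoc)

lemma conjg_inv: "x \<in> carrier W \<Longrightarrow> r \<in> carrier W \<Longrightarrow> conjg x (conjg (inv x) r) = r"
  by (simp add: conjg_mult[symmetric])

lemma conjg_eq_iff:
  "x \<in> carrier W \<Longrightarrow> r \<in> carrier W \<Longrightarrow> t \<in> carrier W \<Longrightarrow> conjg x r = t \<longleftrightarrow> r = conjg (inv x) t"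
  by (metis conjg_inv inv_closed inv_inv)

lemma mult_conjg: "x \<in> carrier W \<Longrightarrow> r \<in> carrier W \<Longrightarrow> x \<otimes> conjg x r = r \<otimes> x"
  by (simp add: conjg_def m_assoc[symmetric])

text \<open>The $i$-th entry is the reflection whose right multiplication deletes the $i$-th letter.\<close>
primrec refl_seq :: "'a list \<Rightarrow> 'a list" where
  "refl_seq [] = []"
| "refl_seq (s # ws) = conjg (word_prod W ws) s # refl_seq ws"

lemma refl_seq_closed: "set ws \<subseteq> carrier W \<Longrightarrow> set (refl_seq ws) \<subseteq> carrier W"
  by (induction ws) auto

lemma refl_seq_append:
  "set us \<subseteq> carrier W \<Longrightarrow> set vs \<subseteq> carrier W \<Longrightarrow>
    refl_seq (us @ vs) = map (conjg (word_prod W vs)) (refl_seq us) @ refl_seq vs"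
  by (induction us) (auto simp: word_prod_append conjg_mult)

lemma refl_seq_delete:
  assumes "t \<in> set (refl_seq ws)" "set ws \<subseteq> S"
  shows "\<exists>us s vs. ws = us @ s # vs \<and> word_prod W ws \<otimes> t = word_prod W (us @ vs)"
  using assms
proof (induction ws)
  case (Cons r ws)
  show ?case
  proof (cases "t = conjg (word_prod W ws) r")
    case True
    then have "word_prod W (r # ws) \<otimes> t = word_prod W ([] @ ws)"
      using Cons.prems by (simp add: m_assoc mult_conjg)
    then show ?thesis by blast
  next
    case False
    then have t: "t \<in> set (refl_seq ws)" using Cons.prems by simp
    then obtain us s vs where "ws = us @ s # vs" "word_prod W ws \<otimes> t = word_prod W (us @ vs)"
      using Cons by auto
    moreover have "t \<in> carrier W"
      using t refl_seq_closed[of ws] Cons.prems gens_closed by auto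
    ultimately have "r # ws = (r # us) @ s # vs"
      "word_prod W (r # ws) \<otimes> t = word_prod W ((r # us) @ vs)"
      using Cons.prems by (auto simp: m_assoc)
    then show ?thesis by blast
  qed
qed simp

text \<open>With \<open>c = s \<otimes> t\<close>, the dihedral relation turns each conjugate that
  arises into some \<open>t \<otimes> c [^] j\<close>. The list is reversed because the leftmost
  letter is conjugated by the longest suffix.\<close>

lemma refl_seq_alternating:
  assumes s: "s \<in> S" and t: "t \<in> S"
  shows "word_prod W (concat (replicate n [s, t])) = (s \<otimes> t) [^] n \<and>
    refl_seq (concat (replicate n [s, t])) = rev (map (\<lambda>j. t \<otimes> (s \<otimes> t) [^] j) [0..<2 * n])"
proof (induction n)
  case (Suc n)
  define c where "c = s \<otimes> t"
  have c: "c \<in> carrier W" using s t by (simp add: c_def)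
  \<comment> \<open>Conjugation by \<open>t\<close> inverts \<open>c\<close>; this form avoids
    inverses and fits natural exponents.\<close>
  have inv_c: "c [^] k \<otimes> t \<otimes> c [^] k = t" for k :: nat
  proof (induction k)
    case (Suc k)
    have "c [^] Suc k \<otimes> t \<otimes> c [^] Suc k = c \<otimes> (c [^] k \<otimes> t \<otimes> c [^] k) \<otimes> c"
      using c t by (subst (1) nat_pow_Suc2) (simp_all add: m_assoc)
    also have "\<dots> = c \<otimes> t \<otimes> c" unfolding Suc ..
    also have "\<dots> = t" using s t by (simp add: c_def m_assoc)
    finally show ?case .
  qed (use t in simp)
  have 1: "conjg (c [^] n) t = t \<otimes> c [^] (2 * n)"
  proof -
    have "c [^] n \<otimes> (t \<otimes> c [^] (2 * n)) = (c [^] n \<otimes> t \<otimes> c [^] n) \<otimes> c [^] n"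
      using c t by (simp add: m_assoc mult_2 nat_pow_mult)
    also have "\<dots> = t \<otimes> c [^] n" unfolding inv_c ..
    finally have "conjg (c [^] n) t = inv (c [^] n) \<otimes> (c [^] n \<otimes> (t \<otimes> c [^] (2 * n)))"
      using c t by (simp add: conjg_def m_assoc)
    then show ?thesis using c t by (simp add: m_assoc[symmetric])
  qed
  have "conjg (t \<otimes> c [^] n) s = conjg (c [^] n) (conjg t s)"
    using c s t by (simp add: conjg_mult)
  also have "conjg t s = t \<otimes> c" using s t by (simp add: conjg_def c_def m_assoc)
  also have "conjg (c [^] n) (t \<otimes> c) = conjg (c [^] n) t \<otimes> c"
    using c t nat_pow_Suc2[OF c, of n] by (simp add: conjg_def m_assoc)
  also have "\<dots> = t \<otimes> c [^] Suc (2 * n)"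
    unfolding 1 using c t by (simp add: m_assoc)
  finally have 2: "conjg (t \<otimes> c [^] n) s = t \<otimes> c [^] Suc (2 * n)" .
  have 3: "s \<otimes> (t \<otimes> c [^] n) = c [^] Suc n"
    using c s t by (subst nat_pow_Suc2) (simp_all add: c_def m_assoc)
  show ?case using Suc 1 2 3 by (simp add: c_def[symmetric] del: nat_pow_Suc)
qed simp

lemma count_list_map_conjg:
  assumes "set l \<subseteq> carrier W" "x \<in> carrier W" "t \<in> carrier W"
  shows "count_list (map (conjg x) l) t = count_list l (conjg (inv x) t)"
  using assms by (induction l) (auto simp: conjg_eq_iff)

text \<open>The power of \<open>s \<otimes> t\<close> to its order is the identity, so the second
  half of the list of reflections repeats the first. The map \<open>f\<close> stands for conjugation
  by whatever follows the relator in a longer word.\<close>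

lemma even_count_relator:
  assumes s: "s \<in> S" and t: "t \<in> S"
  shows "even (count_list (map f (refl_seq (concat (replicate (ord (s \<otimes> t)) [s, t])))) r)"
proof -
  let ?m = "ord (s \<otimes> t)" and ?g = "\<lambda>j. t \<otimes> (s \<otimes> t) [^] j"
  have "map ?g [0..<2 * ?m] = map ?g [0..<?m] @ map (\<lambda>j. ?g (j + ?m)) [0..<?m]"
    by (simp add: mult_2 upt_add_eq_append[of 0] map_add_upt[symmetric] comp_def)
  also have "map (\<lambda>j. ?g (j + ?m)) [0..<?m] = map ?g [0..<?m]"
    using s t by (simp add: nat_pow_mult[symmetric] pow_ord_eq_1)
  finally have "map ?g [0..<2 * ?m] = map ?g [0..<?m] @ map ?g [0..<?m]" .
  then show ?thesis
    using refl_seq_alternating[OF s t, of ?m] by (simp add: rev_map[symmetric])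
qed

text \<open>A relator has product one, so inserting it leaves the conjugations of the letters on its
  left unchanged; its own letters contribute every reflection an even number of times.\<close>

lemma coxeter_equiv_parity:
  assumes "coxeter_equiv W S xs ys"
  shows "even (count_list (refl_seq xs) r) \<longleftrightarrow> even (count_list (refl_seq ys) r)"
  using assms
proof induction
  case (relator xs ys s t)
  let ?R = "concat (replicate (ord (s \<otimes> t)) [s, t])"
  have sub: "set xs \<subseteq> carrier W" "set ys \<subseteq> carrier W" "set ?R \<subseteq> carrier W"
    using relator gens_closed by (auto simp: lists_eq_set)
  have "word_prod W ?R = \<one>"
    using refl_seq_alternating[OF relator(3,4)] relator(3,4) by (simp add: pow_ord_eq_1)
  then have "word_prod W (?R @ ys) = word_prod W ys"
    using sub by (simp add: word_prod_append)
  then have 1: "refl_seq (xs @ ?R @ ys) = map (conjg (word_prod W ys)) (refl_seq xs) @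
      map (conjg (word_prod W ys)) (refl_seq ?R) @ refl_seq ys"
    using sub refl_seq_append[of xs "?R @ ys"] refl_seq_append[of ?R ys] by simp
  show ?case
    using even_count_relator[OF relator(3,4), of "conjg (word_prod W ys)" r]
    by (simp only: 1 refl_seq_append[OF sub(1,2)] count_list_append even_add simp_thms)
qed auto

text \<open>This is the reflection cocycle. By \<open>odd_refl_word\<close> any word of
  \<open>w\<close> may be used to compute it, and by \<open>odd_refl_iff\<close> it singles out the
  right inversions of \<open>w\<close>.\<close>

definition odd_refl :: "'a \<Rightarrow> 'a \<Rightarrow> bool" where
  "odd_refl w t \<longleftrightarrow> (\<exists>ws. set ws \<subseteq> S \<and> word_prod W ws = w \<and> odd (count_list (refl_seq ws) t))"

text \<open>Here the presentation of \<open>W\<close> enters: words with equal product are linked by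
  relators, which preserve parities.\<close>

lemma odd_refl_word:
  assumes "set ws \<subseteq> S"
  shows "odd_refl (word_prod W ws) t \<longleftrightarrow> odd (count_list (refl_seq ws) t)"
proof -
  have "even (count_list (refl_seq us) t) \<longleftrightarrow> even (count_list (refl_seq ws) t)"
    if "set us \<subseteq> S" "word_prod W us = word_prod W ws" for us
    using that assms by (intro coxeter_equiv_parity presentation) (auto simp: lists_eq_set)
  then show ?thesis using assms unfolding odd_refl_def by blast
qed

text \<open>Cocycle rule: a word for \<open>x \<otimes> y\<close> lists the reflections of
  \<open>y\<close> together with those of \<open>x\<close> conjugated by \<open>y\<close>, and
  parities add.\<close>

lemma odd_refl_mult:
  assumes "x \<in> carrier W" "y \<in> carrier W" "t \<in> carrier W"
  shows "odd_refl (x \<otimes> y) t \<longleftrightarrow> odd_refl y t \<noteq> odd_refl x (conjg (inv y) t)"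
proof -
  obtain us vs where w: "set us \<subseteq> S" "word_prod W us = x" "set vs \<subseteq> S" "word_prod W vs = y"
    using ex_word assms by metis
  then have c: "set us \<subseteq> carrier W" "set vs \<subseteq> carrier W" using gens_closed by auto
  have "odd_refl (word_prod W (us @ vs)) t \<longleftrightarrow> odd (count_list (refl_seq (us @ vs)) t)"
    using w by (intro odd_refl_word) auto
  moreover have "count_list (map (conjg y) (refl_seq us)) t = count_list (refl_seq us) (conjg (inv y) t)"
    using assms refl_seq_closed[OF c(1)] by (intro count_list_map_conjg) auto
  moreover have "odd_refl x (conjg (inv y) t) \<longleftrightarrow> odd (count_list (refl_seq us) (conjg (inv y) t))"
    "odd_refl y t \<longleftrightarrow> odd (count_list (refl_seq vs) t)"
    using odd_refl_word w by blast+
  ultimately show ?thesis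
    using c w(2,4) by (auto simp: word_prod_append refl_seq_append)
qed

lemma odd_refl_one [simp]: "\<not> odd_refl \<one> t"
  using odd_refl_word[of "[]" t] by simp

lemma reflections_closed [simp]: "t \<in> reflections \<Longrightarrow> t \<in> carrier W"
  by (auto simp: reflections_def)

lemma gen_reflection: "s \<in> S \<Longrightarrow> s \<in> reflections"
  unfolding reflections_def by (intro CollectI exI[of _ \<one>] exI[of _ s]) simp

lemma conjg_reflection:
  assumes "t \<in> reflections" "x \<in> carrier W"
  shows "conjg x t \<in> reflections"
proof -
  obtain w s where w: "w \<in> carrier W" "s \<in> S" "t = w \<otimes> s \<otimes> inv w"
    using assms(1) unfolding reflections_def by blast
  then have "conjg x t = (inv x \<otimes> w) \<otimes> s \<otimes> inv (inv x \<otimes> w)"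
    using assms(2) unfolding w(3) by (simp add: conjg_def m_assoc inv_mult_group)
  moreover have "inv x \<otimes> w \<in> carrier W" using w(1) assms(2) by simp
  ultimately show ?thesis
    using w(2) unfolding reflections_def
    by (intro CollectI exI[of _ "inv x \<otimes> w"] exI[of _ s]) simp
qed

lemma inv_cancel_left [simp]:
  "w \<in> carrier W \<Longrightarrow> x \<in> carrier W \<Longrightarrow> inv w \<otimes> (w \<otimes> x) = x"
  "w \<in> carrier W \<Longrightarrow> x \<in> carrier W \<Longrightarrow> w \<otimes> (inv w \<otimes> x) = x"
  by (simp_all add: m_assoc[symmetric])

lemma reflection_square [simp]:
  assumes "t \<in> reflections"
  shows "t \<otimes> t = \<one>"
proof -
  obtain w s where w: "w \<in> carrier W" "s \<in> S" "t = w \<otimes> s \<otimes> inv w"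
    using assms unfolding reflections_def by blast
  show ?thesis using w(1,2) unfolding w(3) by (simp add: m_assoc)
qed

lemma reflection_cancel_right [simp]: "t \<in> reflections \<Longrightarrow> w \<in> carrier W \<Longrightarrow> w \<otimes> t \<otimes> t = w"
  by (simp add: m_assoc)

text \<open>Write \<open>t\<close> as \<open>p \<otimes> s \<otimes> inv p\<close>. By the cocycle
  rule the contributions of \<open>p\<close> and \<open>inv p\<close> cancel, since the identity has
  no odd reflection, and the letter \<open>s\<close> remains.\<close>

lemma odd_refl_self:
  assumes "t \<in> reflections"
  shows "odd_refl t t"
proof -
  obtain p s where p: "p \<in> carrier W" "s \<in> S" "t = p \<otimes> s \<otimes> inv p"
    using assms unfolding reflections_def by blast
  have s: "conjg p t = s"
    using p by (simp add: conjg_def m_assoc)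
  have "conjg s s = s" using p(2) by (simp add: conjg_def)
  moreover have "odd_refl s s" using p(2) odd_refl_word[of "[s]" s] by simp
  ultimately have "odd_refl (p \<otimes> s) s \<longleftrightarrow> \<not> odd_refl p s"
    using p by (simp add: odd_refl_mult)
  moreover have "odd_refl (inv p) t \<longleftrightarrow> odd_refl p s"
    using odd_refl_mult[of p "inv p" t] p(1) assms s by simp
  moreover have "odd_refl t t \<longleftrightarrow> odd_refl (inv p) t \<noteq> odd_refl (p \<otimes> s) s"
    using odd_refl_mult[of "p \<otimes> s" "inv p" t] p(1,2) assms s unfolding p(3)[symmetric] by simp
  ultimately show ?thesis by blast
qed

lemma odd_refl_delete:
  assumes "set ws \<subseteq> S" "odd_refl (word_prod W ws) t"
  shows "\<exists>us s vs. ws = us @ s # vs \<and> word_prod W ws \<otimes> t = word_prod W (us @ vs)"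
proof (rule refl_seq_delete)
  have "count_list (refl_seq ws) t \<noteq> 0"
    using assms odd_refl_word[of ws t] by (metis even_zero)
  then show "t \<in> set (refl_seq ws)" by (simp add: count_list_0_iff)
qed (rule assms)

lemma odd_refl_shortens:
  assumes "w \<in> carrier W" "odd_refl w t"
  shows "cox_length (w \<otimes> t) < cox_length w"
proof -
  obtain ws where ws: "reduced ws" "word_prod W ws = w" using ex_reduced assms(1) by blast
  then obtain us s vs where d: "ws = us @ s # vs" "w \<otimes> t = word_prod W (us @ vs)"
    using odd_refl_delete[of ws t] assms(2) by (auto simp: reduced_def)
  then show ?thesis using cox_length_le[of "us @ vs"] ws by (auto simp: reduced_def)
qed

lemma odd_refl_mult_self:
  assumes "w \<in> carrier W" "t \<in> reflections"
  shows "odd_refl (w \<otimes> t) t \<longleftrightarrow> \<not> odd_refl w t"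
proof -
  have "conjg (inv t) t = t" using assms(2) by (simp add: conjg_def inv_equality)
  then show ?thesis using odd_refl_mult[of w t t] odd_refl_self assms by simp
qed

text \<open>Deleting a letter shows that an odd reflection shortens. Exactly one of \<open>w\<close>
  and \<open>w \<otimes> t\<close> has \<open>t\<close> as an odd reflection, which yields the
  converse.\<close>

lemma odd_refl_iff:
  assumes "w \<in> carrier W" "t \<in> reflections"
  shows "odd_refl w t \<longleftrightarrow> cox_length (w \<otimes> t) < cox_length w"
proof
  assume less: "cox_length (w \<otimes> t) < cox_length w"
  show "odd_refl w t"
  proof (rule ccontr)
    assume "\<not> odd_refl w t"
    then have "cox_length (w \<otimes> t \<otimes> t) < cox_length (w \<otimes> t)"
      using assms by (intro odd_refl_shortens) (auto simp: odd_refl_mult_self)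
    with less show False using assms by simp
  qed
qed (rule odd_refl_shortens[OF assms(1)])

lemma cox_length_reflection_neq:
  assumes "w \<in> carrier W" "t \<in> reflections"
  shows "cox_length (w \<otimes> t) \<noteq> cox_length w"
proof
  assume *: "cox_length (w \<otimes> t) = cox_length w"
  show False
    using odd_refl_iff[of w t] odd_refl_iff[of "w \<otimes> t" t] odd_refl_mult_self[of w t] assms *
    by simp
qed

text \<open>The word may be non-reduced; \<open>decreasing_generate\<close> applies this to an
  arbitrary word over a subset of the generators.\<close>

theorem strong_exchange:
  assumes "set ws \<subseteq> S" "t \<in> reflections"
    and "cox_length (word_prod W ws \<otimes> t) < cox_length (word_prod W ws)"
  shows "\<exists>us s vs. ws = us @ s # vs \<and> word_prod W ws \<otimes> t = word_prod W (us @ vs)"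
  using assms by (intro odd_refl_delete) (simp_all add: odd_refl_iff)

lemma cox_length_gen_cases:
  assumes "w \<in> carrier W" "s \<in> S"
  obtains "cox_length (w \<otimes> s) = Suc (cox_length w)" | "cox_length w = Suc (cox_length (w \<otimes> s))"
proof -
  have "cox_length (w \<otimes> s) \<le> Suc (cox_length w)" "cox_length w \<le> Suc (cox_length (w \<otimes> s))"
    using cox_length_mult_le[of w s] cox_length_mult_le[of "w \<otimes> s" s] assms
    by (simp_all add: cox_length_gen)
  then show ?thesis
    using that cox_length_reflection_neq[OF assms(1) gen_reflection[OF assms(2)]] by linarith
qed

section \<open>Bruhat order\<close>

lemma odd_refl_gen:
  assumes "s \<in> S" "t \<in> carrier W"
  shows "odd_refl s t \<longleftrightarrow> t = s"
  using odd_refl_word[of "[s]" t] assms by auto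

lemma bruhat_stepD:
  assumes "bruhat_step x y"
  shows "x \<in> carrier W" "y \<in> carrier W" "cox_length x < cox_length y"
  using assms by (auto simp: bruhat_step_def)

text \<open>Right multiplication by \<open>s\<close> conjugates the right inversions by
  \<open>s\<close> and changes only the status of \<open>s\<close> itself. Hence for
  \<open>t \<noteq> s\<close> the step keeps its direction.\<close>

lemma bruhat_step_mult_gen:
  assumes "bruhat_step x y" "s \<in> S"
  shows "y = x \<otimes> s \<or> bruhat_step (x \<otimes> s) (y \<otimes> s)"
proof -
  obtain t where t: "x \<in> carrier W" "t \<in> reflections" "y = x \<otimes> t" "cox_length x < cox_length y"
    using assms(1) unfolding bruhat_step_def by blast
  show ?thesis
  proof (cases "t = s")
    case False
    let ?t = "conjg s t"
    have r: "?t \<in> reflections" using t assms(2) by (intro conjg_reflection) auto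
    have "x \<otimes> s \<otimes> ?t = y \<otimes> s" using t assms(2) by (simp add: m_assoc mult_conjg)
    moreover have "?t \<noteq> s"
      using False t(2) assms(2) by (simp add: conjg_eq_iff) (simp add: conjg_def m_assoc)
    then have "odd_refl (x \<otimes> s) ?t \<longleftrightarrow> odd_refl x t"
      using t assms(2) conjg_inv[of s t] by (simp add: odd_refl_mult odd_refl_gen)
    then have "\<not> cox_length (x \<otimes> s \<otimes> ?t) < cox_length (x \<otimes> s)"
      using t assms(2) r odd_refl_iff[of "x \<otimes> s" ?t] odd_refl_iff[of x t] by simp
    moreover have "cox_length (x \<otimes> s \<otimes> ?t) \<noteq> cox_length (x \<otimes> s)"
      using t r assms(2) by (intro cox_length_reflection_neq) auto
    ultimately have "bruhat_step (x \<otimes> s) (y \<otimes> s)"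
      using t r assms(2) unfolding bruhat_step_def by (intro conjI bexI[of _ ?t]) auto
    then show ?thesis ..
  qed (use t in simp)
qed

lemma bruhat_step_gen:
  "w \<in> carrier W \<Longrightarrow> s \<in> S \<Longrightarrow> cox_length w < cox_length (w \<otimes> s) \<Longrightarrow> bruhat_step w (w \<otimes> s)"
  unfolding bruhat_step_def using gen_reflection by blast

lemma bruhat_le_closed:
  assumes "bruhat_le x y"
  shows "x \<in> carrier W" "y \<in> carrier W"
proof -
  have "bruhat_step\<^sup>*\<^sup>* x y" and x: "x \<in> carrier W" using assms by (auto simp: bruhat_le_def)
  then show "x \<in> carrier W" "y \<in> carrier W" by (auto elim: rtranclp.cases dest: bruhat_stepD)
qed

lemma bruhat_le_refl [simp]: "bruhat_le x x \<longleftrightarrow> x \<in> carrier W"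
  by (simp add: bruhat_le_def)

lemma bruhat_le_trans: "bruhat_le x y \<Longrightarrow> bruhat_le y z \<Longrightarrow> bruhat_le x z"
  by (auto simp: bruhat_le_def)

lemma bruhat_step_le: "bruhat_step x y \<Longrightarrow> bruhat_le x y"
  by (auto simp: bruhat_le_def dest: bruhat_stepD)

lemma bruhat_le_length:
  assumes "bruhat_le x y"
  shows "x = y \<or> cox_length x < cox_length y"
proof -
  have "bruhat_step\<^sup>*\<^sup>* x y" using assms by (simp add: bruhat_le_def)
  then show ?thesis by induction (auto dest: bruhat_stepD)
qed

text \<open>Along the chain from \<open>x\<close> to \<open>y\<close>, a step is either carried
  along by \<open>s\<close> or has the form from \<open>x\<close> to \<open>x \<otimes> s\<close>,
  and then \<open>x \<otimes> s\<close> is itself on the chain.\<close>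

lemma bruhat_le_mult_gen_left:
  assumes "bruhat_le x y" "s \<in> S"
  shows "bruhat_le (x \<otimes> s) y \<or> bruhat_le (x \<otimes> s) (y \<otimes> s)"
proof -
  have y: "y \<in> carrier W" using bruhat_le_closed assms by blast
  have "bruhat_step\<^sup>*\<^sup>* x y" using assms by (simp add: bruhat_le_def)
  then show ?thesis
  proof (induction rule: converse_rtranclp_induct)
    case base
    then show ?case using y assms(2) by simp
  next
    case (step x z)
    from step(1) have "bruhat_le z y"
      using step(2) bruhat_stepD(2) by (auto simp: bruhat_le_def)
    then show ?case
      using bruhat_step_mult_gen[OF step(1) assms(2)] step(3) bruhat_step_le bruhat_le_trans by blast
  qed
qed

lemma bruhat_le_mult_gen_right:
  assumes "bruhat_le x y" "s \<in> S"
  shows "bruhat_le x (y \<otimes> s) \<or> bruhat_le (x \<otimes> s) (y \<otimes> s)"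
proof -
  have x: "x \<in> carrier W" using bruhat_le_closed assms by blast
  have "bruhat_step\<^sup>*\<^sup>* x y" using assms by (simp add: bruhat_le_def)
  then show ?thesis
  proof (induction rule: rtranclp_induct)
    case base
    then show ?case using x assms(2) by simp
  next
    case (step z y)
    have z: "z \<in> carrier W" "bruhat_le x z" using step bruhat_stepD x by (auto simp: bruhat_le_def)
    from bruhat_step_mult_gen[OF step(2) assms(2)] show ?case
    proof
      assume "y = z \<otimes> s"
      then show ?thesis using z assms(2) by simp
    next
      assume "bruhat_step (z \<otimes> s) (y \<otimes> s)"
      then show ?thesis using step(3) bruhat_step_le bruhat_le_trans by blast
    qed
  qed
qed

lemma bruhat_le_gen:
  assumes "w \<in> carrier W" "s \<in> S" "cox_length (w \<otimes> s) < cox_length w"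
  shows "bruhat_le (w \<otimes> s) w"
  using bruhat_step_gen[of "w \<otimes> s" s] assms by (intro bruhat_step_le) simp

lemma bruhat_le_mult_descent:
  assumes "bruhat_le x y" "s \<in> S" "cox_length (y \<otimes> s) < cox_length y"
  shows "bruhat_le (x \<otimes> s) y"
  using bruhat_le_mult_gen_left[OF assms(1,2)] bruhat_le_gen[of y s] assms bruhat_le_closed
    bruhat_le_trans by blast

text \<open>The lifting property: either alternative of \<open>bruhat_le_mult_gen_right\<close>
  gives the claim, the second because \<open>x\<close> lies below
  \<open>x \<otimes> s\<close>.\<close>

lemma bruhat_lifting:
  assumes "bruhat_le x y" "s \<in> S" "cox_length (y \<otimes> s) < cox_length y"
    and "cox_length x < cox_length (x \<otimes> s)"
  shows "bruhat_le x (y \<otimes> s)"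
  using bruhat_le_mult_gen_right[OF assms(1,2)] bruhat_step_gen[of x s] assms bruhat_le_closed
    bruhat_le_trans bruhat_step_le by blast

section \<open>Gradedness of the Bruhat order and covers\<close>

lemma ex_right_descent:
  assumes "w \<in> carrier W" "w \<noteq> \<one>"
  shows "\<exists>s \<in> S. cox_length (w \<otimes> s) < cox_length w"
proof -
  obtain ws where ws: "reduced ws" "word_prod W ws = w" using ex_reduced assms(1) by blast
  then obtain us s where us: "ws = us @ [s]" using assms(2) by (cases ws rule: rev_cases) auto
  then have S: "set us \<subseteq> S" "s \<in> S" using ws by (auto simp: reduced_def)
  then have "w \<otimes> s = word_prod W us" using ws us by (auto simp: word_prod_snoc)
  then have "cox_length (w \<otimes> s) \<le> length us" using S cox_length_le by simp
  then show ?thesis using S ws us by (auto simp: reduced_def intro!: bexI[of _ s])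
qed

text \<open>A right descent \<open>s\<close> of \<open>y\<close> gives the coatom
  \<open>y \<otimes> s\<close>; if \<open>s\<close> is no descent of \<open>x\<close>, lifting
  places \<open>x\<close> below it. Otherwise induction applies to \<open>x \<otimes> s\<close> and
  \<open>y \<otimes> s\<close>, and the element found between them is multiplied back by
  \<open>s\<close>.\<close>

lemma bruhat_chain:
  assumes "bruhat_le x y" "x \<noteq> y"
  shows "\<exists>z. bruhat_le x z \<and> bruhat_le z y \<and> cox_length y = Suc (cox_length z)"
  using assms
proof (induction "cox_length y" arbitrary: x y rule: less_induct)
  case less
  note c = bruhat_le_closed[OF less(2)]
  have "cox_length x < cox_length y" using bruhat_le_length less by blast
  then have "y \<noteq> \<one>" by auto
  then obtain s where s: "s \<in> S" and ys: "cox_length (y \<otimes> s) < cox_length y"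
    using ex_right_descent c by blast
  have l: "cox_length y = Suc (cox_length (y \<otimes> s))"
    using ys by (cases rule: cox_length_gen_cases[OF c(2) s]) auto
  have le: "bruhat_le (y \<otimes> s) y" using bruhat_le_gen c s ys by blast
  show ?case
  proof (cases "cox_length x < cox_length (x \<otimes> s)")
    case True
    then have "bruhat_le x (y \<otimes> s)" using bruhat_lifting less s ys by blast
    then show ?thesis using l le by blast
  next
    case False
    then have xs: "cox_length (x \<otimes> s) < cox_length x"
      by (cases rule: cox_length_gen_cases[OF c(1) s]) auto
    have "bruhat_le (x \<otimes> s) y" using bruhat_le_gen c s xs less(2) bruhat_le_trans by blast
    then have "bruhat_le (x \<otimes> s) (y \<otimes> s)"
      using bruhat_lifting[of "x \<otimes> s" y s] c s ys xs by simp
    moreover have "x \<otimes> s \<noteq> y \<otimes> s" using less(3) c s by simp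
    ultimately obtain z where z: "bruhat_le (x \<otimes> s) z" "bruhat_le z (y \<otimes> s)"
      "cox_length (y \<otimes> s) = Suc (cox_length z)"
      using less(1)[of "y \<otimes> s" "x \<otimes> s"] ys by blast
    then have zc: "z \<in> carrier W" using bruhat_le_closed by blast
    show ?thesis
    proof (cases rule: cox_length_gen_cases[OF zc s])
      case 1
      have "bruhat_le z y" using z(2) le bruhat_le_trans by blast
      then have "bruhat_le (z \<otimes> s) y" using bruhat_le_mult_descent s ys by blast
      moreover have "bruhat_le (x \<otimes> s) (z \<otimes> s)"
        using z(1) bruhat_step_gen[OF zc s] 1 bruhat_step_le bruhat_le_trans by (metis lessI)
      then have "bruhat_le x (z \<otimes> s)"
        using bruhat_le_mult_descent[of "x \<otimes> s" "z \<otimes> s" s] 1 zc c s by simp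
      ultimately show ?thesis using 1 l z(3) by auto
    next
      \<comment> \<open>Here \<open>s\<close> is a descent of \<open>z\<close>, so \<open>x\<close>
        already lies below \<open>z\<close>, and \<open>y \<otimes> s\<close> serves as the
        coatom.\<close>
      case 2
      have "bruhat_le x z"
        using bruhat_le_mult_descent[OF z(1) s] 2 c s by simp
      then have "bruhat_le x (y \<otimes> s)" using z(2) bruhat_le_trans by blast
      then show ?thesis using l le by blast
    qed
  qed
qed

text \<open>Gradedness turns the order-theoretic cover into a condition on lengths.\<close>

lemma covered_by_iff: "covered_by x y \<longleftrightarrow> bruhat_le x y \<and> cox_length y = Suc (cox_length x)"
proof
  assume c: "covered_by x y"
  then have le: "bruhat_le x y" "x \<noteq> y" by (auto simp: covered_by_def bruhat_less_def)
  then obtain z where z: "bruhat_le x z" "bruhat_le z y" "cox_length y = Suc (cox_length z)"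
    using bruhat_chain by blast
  then have "z \<noteq> y" by auto
  then have "z = x" using c z by (auto simp: covered_by_def bruhat_less_def)
  then show "bruhat_le x y \<and> cox_length y = Suc (cox_length x)" using z le by simp
next
  assume a: "bruhat_le x y \<and> cox_length y = Suc (cox_length x)"
  then have "bruhat_less x y" by (auto simp: bruhat_less_def)
  moreover have "\<not> (bruhat_less x z \<and> bruhat_less z y)" for z
    using a bruhat_le_length[of x z] bruhat_le_length[of z y] by (auto simp: bruhat_less_def)
  ultimately show "covered_by x y" by (auto simp: covered_by_def)
qed

lemma covered_by_closed: "covered_by x y \<Longrightarrow> x \<in> carrier W" "covered_by x y \<Longrightarrow> y \<in> carrier W"
  using bruhat_le_closed by (auto simp: covered_by_iff)

lemma covered_by_length: "covered_by x y \<Longrightarrow> cox_length y = Suc (cox_length x)"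
  by (simp add: covered_by_iff)

lemma covered_by_asym: "covered_by x y \<Longrightarrow> \<not> covered_by y x"
  using covered_by_length[of x y] covered_by_length[of y x] by auto

lemma coat_iff: "x \<in> coat y \<longleftrightarrow> covered_by x y"
  by (simp add: coat_def)

lemma bruhat_le_coat:
  assumes "bruhat_le x y"
  shows "x = y \<or> (\<exists>z \<in> coat y. bruhat_le x z)"
  using bruhat_chain[OF assms] coat_iff covered_by_iff by blast

lemma reflection_covered_by:
  assumes "w \<in> carrier W" "t \<in> reflections" "cox_length w = Suc (cox_length (w \<otimes> t))"
  shows "covered_by (w \<otimes> t) w"
proof -
  have "bruhat_step (w \<otimes> t) w"
    using assms unfolding bruhat_step_def by (intro conjI bexI[of _ t]) auto
  then show ?thesis using assms bruhat_step_le by (simp add: covered_by_iff)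
qed

lemma descent_covered_by:
  assumes "w \<in> carrier W" "s \<in> S" "cox_length (w \<otimes> s) < cox_length w"
  shows "covered_by (w \<otimes> s) w"
proof (rule reflection_covered_by)
  show "cox_length w = Suc (cox_length (w \<otimes> s))"
    using assms(3) by (cases rule: cox_length_gen_cases[OF assms(1,2)]) auto
qed (use assms gen_reflection in auto)

text \<open>If \<open>s\<close> is no descent of \<open>z\<close>, lifting puts \<open>z\<close>
  below \<open>y \<otimes> s\<close>, which has the same length.\<close>

lemma covered_by_descent_cases:
  assumes "covered_by z y" "s \<in> S" "cox_length (y \<otimes> s) < cox_length y"
  shows "z = y \<otimes> s \<or> cox_length (z \<otimes> s) < cox_length z"
proof (rule ccontr)
  note c = covered_by_closed[OF assms(1)]
  assume a: "\<not> ?thesis"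
  then have "cox_length z < cox_length (z \<otimes> s)"
    by (cases rule: cox_length_gen_cases[OF c(1) assms(2)]) auto
  then have "bruhat_le z (y \<otimes> s)" using bruhat_lifting assms by (auto simp: covered_by_iff)
  then show False
    using a bruhat_le_length[of z "y \<otimes> s"] assms(1,3) covered_by_length[of z y] by auto
qed

section \<open>Standard parabolic subgroups\<close>

lemma generate_gens_closed: "J \<subseteq> S \<Longrightarrow> generate W J \<subseteq> carrier W"
  using gens_closed by (intro generate_incl) auto

text \<open>Exchange shortens a word by deleting a letter, so passing to a reduced word introduces
  no letter outside \<open>J\<close>.\<close>

lemma ex_reduced_generate:
  assumes "J \<subseteq> S" "w \<in> generate W J"
  shows "\<exists>ws. reduced ws \<and> set ws \<subseteq> J \<and> word_prod W ws = w"
proof -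
  have "\<exists>vs. reduced vs \<and> set vs \<subseteq> J \<and> word_prod W vs = word_prod W ws" if "set ws \<subseteq> J" for ws
    using that
  proof (induction ws rule: rev_induct)
    case Nil
    show ?case by (intro exI[of _ "[]"]) (simp add: reduced_def)
  next
    case (snoc s ws)
    then obtain vs where vs: "reduced vs" "set vs \<subseteq> J" "word_prod W vs = word_prod W ws"
      by auto
    have s: "s \<in> S" "s \<in> J" and S: "set ws \<subseteq> S" "set vs \<subseteq> S" using snoc vs assms(1) by auto
    have eq: "word_prod W (vs @ [s]) = word_prod W (ws @ [s])"
      using s S vs by (simp add: word_prod_snoc)
    have c: "word_prod W vs \<in> carrier W" using S by simp
    show ?case
    proof (cases rule: cox_length_gen_cases[OF c s(1)])
      case 1
      then have "reduced (vs @ [s])" using vs s S by (simp add: reduced_def word_prod_snoc)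
      then show ?thesis using vs s eq by (intro exI[of _ "vs @ [s]"]) auto
    next
      case 2
      then obtain us r us' where d: "vs = us @ r # us'"
        "word_prod W vs \<otimes> s = word_prod W (us @ us')"
        using strong_exchange[OF S(2) gen_reflection[OF s(1)]] by auto
      then have "reduced (us @ us')"
        using 2 vs(1) S by (intro reducedI) (auto simp: reduced_def)
      moreover have "word_prod W (us @ us') = word_prod W (ws @ [s])"
        using d(2) eq S s by (simp add: word_prod_snoc)
      ultimately show ?thesis using vs(2) d(1) by (intro exI[of _ "us @ us'"]) auto
    qed
  qed
  then show ?thesis using generate_iff_word[OF assms(1), of w] assms(2) by metis
qed

lemma generate_mult_gen_iff:
  assumes "J \<subseteq> S" "s \<in> J" "w \<in> carrier W"
  shows "w \<otimes> s \<in> generate W J \<longleftrightarrow> w \<in> generate W J"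
proof -
  have s: "s \<in> S" "s \<in> generate W J" using assms generate.incl by auto
  have "w \<otimes> s \<otimes> s \<in> generate W J" if "w \<otimes> s \<in> generate W J"
    using that s(2) by (rule generate.eng)
  then show ?thesis using s assms(3) generate.eng[of w W J s] by auto
qed

text \<open>A Bruhat step downwards deletes a letter from any chosen word, in particular from one
  over \<open>J\<close>.\<close>

lemma decreasing_generate:
  assumes "J \<subseteq> S"
  shows "decreasing (generate W J)"
  unfolding decreasing_def
proof (intro conjI ballI allI impI)
  fix y x assume y: "y \<in> generate W J" and "bruhat_le x y"
  then have "bruhat_step\<^sup>*\<^sup>* x y" by (simp add: bruhat_le_def)
  then show "x \<in> generate W J"
  proof (induction rule: converse_rtranclp_induct)
    case (step x z)
    obtain t where t: "x \<in> carrier W" "t \<in> reflections" "z = x \<otimes> t" "cox_length x < cox_length z"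
      using step(1) unfolding bruhat_step_def by blast
    obtain ws where ws: "set ws \<subseteq> J" "word_prod W ws = z"
      using step(3) generate_iff_word assms by blast
    moreover have "z \<otimes> t = x" "set ws \<subseteq> S" using t ws(1) assms by auto
    ultimately obtain us r vs where "ws = us @ r # vs" "x = word_prod W (us @ vs)"
      using strong_exchange[of ws t] t by auto
    moreover from this have "set (us @ vs) \<subseteq> J" using ws by auto
    ultimately show ?case using generate_iff_word[OF assms, of x] by blast
  qed (rule y)
qed (use generate_gens_closed[OF assms] in auto)

lemma decreasing_generateD:
  "J \<subseteq> S \<Longrightarrow> y \<in> generate W J \<Longrightarrow> covered_by x y \<Longrightarrow> x \<in> generate W J"
  using decreasing_generate[of J] by (auto simp: decreasing_def covered_by_iff)

lemma gen_in_generate_iff: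
  assumes "J \<subseteq> S" "s \<in> S"
  shows "s \<in> generate W J \<longleftrightarrow> s \<in> J"
proof
  assume "s \<in> generate W J"
  then obtain ws where ws: "reduced ws" "set ws \<subseteq> J" "word_prod W ws = s"
    using ex_reduced_generate assms by blast
  then have "length ws = 1" using cox_length_gen assms(2) by (simp add: reduced_def)
  then obtain r where "ws = [r]" by (auto simp: length_Suc_conv)
  then show "s \<in> J" using ws assms by (auto simp: subset_iff)
qed (rule generate.incl)

text \<open>Cutting off the last letter leads to a covered element, which stays in the subgroup
  because the subgroup is decreasing; the letter is then a quotient of two members.\<close>

lemma reduced_letters_generate:
  assumes "J \<subseteq> S" "reduced ws" "word_prod W ws \<in> generate W J"
  shows "set ws \<subseteq> J"
  using assms(2,3)
proof (induction ws rule: rev_induct)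
  case (snoc s ws)
  have S: "set ws \<subseteq> S" "s \<in> S" using snoc(2) by (auto simp: reduced_def)
  have w: "word_prod W (ws @ [s]) = word_prod W ws \<otimes> s" using S by (simp add: word_prod_snoc)
  have ws: "reduced ws" using reduced_append snoc(2) by blast
  have "cox_length (word_prod W ws \<otimes> s) = Suc (cox_length (word_prod W ws))"
    using snoc(2) ws w by (simp add: reduced_def)
  then have "covered_by (word_prod W ws) (word_prod W ws \<otimes> s)"
    using S descent_covered_by[of "word_prod W ws \<otimes> s" s] by simp
  then have g: "word_prod W ws \<in> generate W J"
    using decreasing_generateD[OF assms(1)] snoc(3) w by metis
  have "inv (word_prod W ws) \<in> generate W J"
    using g assms(1) gens_closed by (intro generate_m_inv_closed) auto
  then have "inv (word_prod W ws) \<otimes> (word_prod W ws \<otimes> s) \<in> generate W J"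
    using snoc(3) unfolding w by (rule generate.eng)
  then have "s \<in> J" using S assms(1) gen_in_generate_iff by simp
  then show ?case using snoc(1)[OF ws g] by simp
qed simp

text \<open>A reduced word over \<open>J\<close> of a common element has all its letters in
  \<open>K\<close> as well, by \<open>reduced_letters_generate\<close>.\<close>

lemma generate_Int:
  assumes "J \<subseteq> S" "K \<subseteq> S"
  shows "generate W J \<inter> generate W K = generate W (J \<inter> K)"
proof (intro equalityI subsetI)
  fix w assume w: "w \<in> generate W J \<inter> generate W K"
  then obtain ws where ws: "reduced ws" "set ws \<subseteq> J" "word_prod W ws = w"
    using ex_reduced_generate assms by blast
  then have "set ws \<subseteq> K" using reduced_letters_generate[OF assms(2)] w by blast
  then show "w \<in> generate W (J \<inter> K)"
    using ws assms generate_iff_word[of "J \<inter> K"] by blast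
qed (use mono_generate[of "J \<inter> K" J] mono_generate[of "J \<inter> K" K] in auto)

lemma generate_gen:
  assumes "a \<in> S"
  shows "generate W {a} = {\<one>, a}"
proof (intro equalityI subsetI)
  fix w assume "w \<in> generate W {a}"
  then obtain ws where "set ws \<subseteq> {a}" "word_prod W ws = w"
    using generate_iff_word[of "{a}"] assms by auto
  then show "w \<in> {\<one>, a}"
    by (induction ws arbitrary: w) (use assms in auto)
qed (auto intro: generate.intros)

lemma reduced_Cons_covered_by:
  assumes "reduced (r # ws)"
  shows "covered_by (word_prod W ws) (word_prod W (r # ws))"
proof -
  have S: "r \<in> S" "set ws \<subseteq> S" using assms by (auto simp: reduced_def)
  let ?v = "word_prod W ws" and ?w = "word_prod W (r # ws)"
  have w: "?w \<otimes> conjg ?v r = ?v" using S by (simp add: m_assoc mult_conjg)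
  have "reduced ws" using reduced_append[of "[r]" ws] assms by simp
  then have "cox_length ?w = Suc (cox_length (?w \<otimes> conjg ?v r))"
    unfolding w using assms by (simp add: reduced_def)
  then have "covered_by (?w \<otimes> conjg ?v r) ?w"
    using S by (intro reflection_covered_by conjg_reflection gen_reflection) auto
  then show ?thesis unfolding w .
qed

lemma reduced_snoc_covered_by:
  assumes "reduced (ws @ [s])"
  shows "covered_by (word_prod W ws) (word_prod W (ws @ [s]))"
proof -
  have S: "s \<in> S" "set ws \<subseteq> S" using assms by (auto simp: reduced_def)
  have "reduced ws" using reduced_append[of ws "[s]"] assms by simp
  then have "cox_length (word_prod W (ws @ [s])) = Suc (cox_length (word_prod W ws))"
    using assms by (simp add: reduced_def)
  then show ?thesis
    using S descent_covered_by[of "word_prod W (ws @ [s])" s] by (simp add: word_prod_snoc)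
qed

text \<open>Removing the first or the last letter of a reduced word yields two coatoms, which
  together show all letters once the length is at least two. A generator outside \<open>J\<close>
  has \<open>{\<one>}\<close> as its set of coatoms, whence the bound.\<close>

lemma generate_if_coat:
  assumes "J \<subseteq> S" "x \<in> carrier W" "cox_length x \<ge> 2" "coat x \<subseteq> generate W J"
  shows "x \<in> generate W J"
proof -
  obtain ws where ws: "reduced ws" "word_prod W ws = x" using ex_reduced assms(2) by blast
  then have l: "length ws \<ge> 2" using assms(3) by (simp add: reduced_def)
  then obtain r vs where r: "ws = r # vs" by (cases ws) auto
  then have "vs \<noteq> []" using l by auto
  then obtain us s where s: "vs = us @ [s]" by (cases vs rule: rev_cases) auto
  have red: "reduced (r # us)" "reduced vs"
    using ws(1) r s reduced_append[of "r # us" "[s]"] reduced_append[of "[r]" vs] by auto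
  have "word_prod W vs \<in> coat x" "word_prod W (r # us) \<in> coat x"
    using ws r s reduced_Cons_covered_by[of r vs] reduced_snoc_covered_by[of "r # us" s]
    by (auto simp: coat_iff)
  then have "set vs \<subseteq> J" "set (r # us) \<subseteq> J"
    using red assms(1,4) reduced_letters_generate by blast+
  then have "set ws \<subseteq> J" using r by auto
  then show ?thesis using ws generate_iff_word[OF assms(1)] by blast
qed

text \<open>Otherwise removing the first letter \<open>r\<close> and removing the last letter of a
  reduced word of \<open>x\<close> both give \<open>u\<close>. So \<open>x = r \<otimes> u\<close>,
  while \<open>u\<close> has a word beginning with \<open>r\<close>, and the two letters
  cancel.\<close>

lemma coat_singleton:
  assumes "coat x = {u}"
  shows "u = \<one>"
proof (rule ccontr)
  assume "u \<noteq> \<one>"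
  have c: "covered_by u x" using assms by (simp add: coat_iff[symmetric])
  obtain ws where ws: "reduced ws" "word_prod W ws = x"
    using ex_reduced covered_by_closed[OF c] by blast
  have "length ws = Suc (cox_length u)" using ws covered_by_length[OF c] by (simp add: reduced_def)
  moreover have "cox_length u \<noteq> 0"
    using \<open>u \<noteq> \<one>\<close> cox_length_eq_0 covered_by_closed[OF c] by simp
  ultimately have l: "length ws \<ge> 2" by simp
  then obtain r vs where r: "ws = r # vs" by (cases ws) auto
  then have "vs \<noteq> []" using l by auto
  then obtain us s where s: "vs = us @ [s]" by (cases vs rule: rev_cases) auto
  have S: "r \<in> S" "s \<in> S" "set us \<subseteq> S" using ws r s by (auto simp: reduced_def)
  have "word_prod W vs = u" "word_prod W (r # us) = u"
    using ws r s assms reduced_Cons_covered_by[of r vs] reduced_snoc_covered_by[of "r # us" s]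
    by (auto simp: coat_iff[symmetric])
  then have "x = r \<otimes> word_prod W (r # us)" using ws r by simp
  then have "x = word_prod W us" using S by simp
  then have "cox_length x \<le> length us" using S cox_length_le by simp
  then show False using ws r s by (auto simp: reduced_def)
qed

section \<open>Elements with the same coatoms\<close>

text \<open>The element \<open>x \<otimes> s\<close> is a coatom of both. Since \<open>s\<close> is
  a descent of \<open>y\<close>, multiplying it by \<open>s\<close> stays below \<open>y\<close>; so
  \<open>x\<close> lies below \<open>y\<close>, and the lengths agree.\<close>

lemma coat_eq_common_descent:
  assumes "coat x = coat y" "x \<in> carrier W" "y \<in> carrier W" "s \<in> S"
    and "cox_length (x \<otimes> s) < cox_length x" "cox_length (y \<otimes> s) < cox_length y"
  shows "x = y"
proof -
  have x: "covered_by (x \<otimes> s) x" using descent_covered_by assms by blast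
  then have y: "covered_by (x \<otimes> s) y" using assms(1) by (simp add: coat_iff[symmetric])
  then have "bruhat_le x y"
    using bruhat_le_mult_descent[of "x \<otimes> s" y s] assms by (simp add: covered_by_iff)
  then show ?thesis
    using bruhat_le_length[of x y] covered_by_length[OF x] covered_by_length[OF y] assms by simp
qed

text \<open>
  Write $x = r z$ with $r$ the first letter of \<open>ws\<close>. Since $t$ is not a descent of $x$, it is not
  one of $z$, so lifting $z < y$ forces $z = y t$; this moves $r$ away and appends $t$ to \<open>vs\<close>,
  while $x$ and $y$ exchange their roles.
\<close>
lemma coat_eq_distinct_descents:
  assumes "coat x = coat y" "x \<in> carrier W" "y \<in> carrier W" "s \<in> S" "t \<in> S"
    and "cox_length (x \<otimes> s) < cox_length x" "cox_length (y \<otimes> t) < cox_length y"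
    and "\<not> cox_length (x \<otimes> t) < cox_length x" "\<not> cox_length (y \<otimes> s) < cox_length y"
    and "reduced (ws @ vs)" "word_prod W (ws @ vs) = x" "set vs \<subseteq> {s, t}"
  shows "x \<in> generate W {s, t}"
  using assms
proof (induction ws arbitrary: x y s t vs)
  case Nil
  then show ?case using generate_iff_word[of "{s, t}" x] by auto
next
  case (Cons r ws)
  let ?z = "word_prod W (ws @ vs)"
  have S: "r \<in> S" "set (ws @ vs) \<subseteq> S" using Cons.prems(10) by (auto simp: reduced_def)
  have z: "?z \<in> carrier W" "x = r \<otimes> ?z" using S Cons.prems(11) by auto
  have zx: "covered_by ?z x"
    using reduced_Cons_covered_by[of r "ws @ vs"] Cons.prems(10,11) by simp
  then have zy: "covered_by ?z y" using Cons.prems(1) by (simp add: coat_iff[symmetric])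
  have "\<not> cox_length (?z \<otimes> t) < cox_length ?z"
  proof
    assume "cox_length (?z \<otimes> t) < cox_length ?z"
    moreover have "cox_length (x \<otimes> t) \<le> Suc (cox_length (?z \<otimes> t))"
      using cox_length_mult_le[of r "?z \<otimes> t"] S z Cons.prems(5)
      by (simp add: m_assoc cox_length_gen)
    ultimately show False using Cons.prems(8) covered_by_length[OF zx] by linarith
  qed
  then have "?z = y \<otimes> t" using covered_by_descent_cases[OF zy] Cons.prems by blast
  then have y: "y = ?z \<otimes> t" using Cons.prems by simp
  have w: "word_prod W (ws @ (vs @ [t])) = y"
    using y S Cons.prems(5) word_prod_snoc[of "ws @ vs" t] by simp
  have "length (ws @ (vs @ [t])) = cox_length y"
    using covered_by_length[OF zx] covered_by_length[OF zy] Cons.prems(10,11) by (simp add: reduced_def)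
  then have "reduced (ws @ (vs @ [t]))" using S Cons.prems(5) w by (simp add: reduced_def)
  then have g: "y \<in> generate W {t, s}"
    using Cons.prems w by (intro Cons.IH[of y x t s "vs @ [t]"]) auto
  have "covered_by (x \<otimes> s) x" using descent_covered_by Cons.prems by blast
  then have "covered_by (x \<otimes> s) y" using Cons.prems(1) by (simp add: coat_iff[symmetric])
  then have "x \<otimes> s \<in> generate W {t, s}" using g decreasing_generateD Cons.prems by blast
  then show ?case
    using generate_mult_gen_iff[of "{t, s}" s x] Cons.prems by (simp add: insert_commute)
qed

lemma coat_eq_cases:
  assumes "coat x = coat y" "x \<in> carrier W" "y \<in> carrier W" "s \<in> S" "t \<in> S"
    and "cox_length (x \<otimes> s) < cox_length x" "cox_length (y \<otimes> t) < cox_length y"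
  shows "x = y \<or> s \<noteq> t \<and> x \<in> generate W {s, t}"
proof (cases "cox_length (x \<otimes> t) < cox_length x \<or> cox_length (y \<otimes> s) < cox_length y")
  case True
  then show ?thesis using coat_eq_common_descent assms by blast
next
  case False
  obtain ws where "reduced ws" "word_prod W ws = x" using ex_reduced assms(2) by blast
  then have "x \<in> generate W {s, t}"
    using False assms by (intro coat_eq_distinct_descents[of x y s t ws "[]"]) auto
  then show ?thesis using False assms by blast
qed

section \<open>Dihedral parabolic subgroups\<close>

text \<open>A right descent of \<open>w\<close> in \<open>S\<close> lies in \<open>J\<close>, being
  a quotient of \<open>w\<close> and the element it covers.\<close>

lemma generate_ex_descent:
  assumes "J \<subseteq> S" "w \<in> generate W J" "w \<noteq> \<one>"
  shows "\<exists>c \<in> J. cox_length (w \<otimes> c) < cox_length w"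
proof -
  have w: "w \<in> carrier W" using assms generate_gens_closed by blast
  obtain s where s: "s \<in> S" "cox_length (w \<otimes> s) < cox_length w"
    using ex_right_descent w assms(3) by blast
  then have ws: "w \<otimes> s \<in> generate W J"
    using decreasing_generateD[OF assms(1,2)] descent_covered_by w by blast
  have "inv w \<in> generate W J"
    using assms gens_closed by (intro generate_m_inv_closed) auto
  then have "inv w \<otimes> (w \<otimes> s) \<in> generate W J" using ws by (rule generate.eng)
  then show ?thesis using s w gen_in_generate_iff[OF assms(1) s(1)] by auto
qed

text \<open>Length is that of \<open>W\<close>. The case \<open>s = t\<close> and infinite order of
  \<open>s \<otimes> t\<close> are included; a level may be empty or have one element.\<close>

definition dihedral_level :: "'a \<Rightarrow> 'a \<Rightarrow> nat \<Rightarrow> 'a set" where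
  "dihedral_level s t n = {w \<in> generate W {s, t}. cox_length w = n}"

lemma dihedral_level_closed:
  "s \<in> S \<Longrightarrow> t \<in> S \<Longrightarrow> w \<in> dihedral_level s t n \<Longrightarrow> w \<in> carrier W"
  using generate_gens_closed[of "{s, t}"] by (auto simp: dihedral_level_def)

lemma dihedral_level_length: "w \<in> dihedral_level s t n \<Longrightarrow> cox_length w = n"
  by (simp add: dihedral_level_def)

lemma dihedral_level_0:
  assumes "s \<in> S" "t \<in> S"
  shows "dihedral_level s t 0 = {\<one>}"
proof -
  have "w \<in> dihedral_level s t 0 \<longleftrightarrow> w = \<one>" for w
    using dihedral_level_closed[OF assms, of w 0] cox_length_eq_0[of w] generate.one[of W "{s, t}"]
    unfolding dihedral_level_def by auto
  then show ?thesis by blast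
qed

lemma dihedral_level_ex_descent:
  assumes "s \<in> S" "t \<in> S" "w \<in> dihedral_level s t (Suc n)"
  obtains c where "c \<in> {s, t}" "w \<otimes> c \<in> dihedral_level s t n" "covered_by (w \<otimes> c) w"
proof -
  have J: "{s, t} \<subseteq> S" using assms by simp
  have w: "w \<in> carrier W" "w \<in> generate W {s, t}" "cox_length w = Suc n"
    using dihedral_level_closed assms by (auto simp: dihedral_level_def)
  have "w \<noteq> \<one>" using w(3) by (metis cox_length_one nat.distinct(1))
  then obtain c where c: "c \<in> {s, t}" "cox_length (w \<otimes> c) < cox_length w"
    using generate_ex_descent[OF J w(2)] by blast
  have cov: "covered_by (w \<otimes> c) w" using w c J by (intro descent_covered_by) blast+
  moreover have "w \<otimes> c \<in> dihedral_level s t n"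
    using decreasing_generateD[OF J w(2) cov] covered_by_length[OF cov] w(3)
    by (simp add: dihedral_level_def)
  ultimately show ?thesis using that c(1) by blast
qed

lemma dihedral_level_mult_descent:
  assumes "s \<in> S" "t \<in> S" "w \<in> dihedral_level s t (Suc n)" "c \<in> {s, t}"
    and "cox_length (w \<otimes> c) < cox_length w"
  shows "w \<otimes> c \<in> dihedral_level s t n"
proof -
  have J: "{s, t} \<subseteq> S" using assms by simp
  have cov: "covered_by (w \<otimes> c) w"
    using descent_covered_by dihedral_level_closed[OF assms(1-3)] assms(4,5) J by blast
  then show ?thesis
    using decreasing_generateD[OF J _ cov] covered_by_length[OF cov] assms(3)
    by (simp add: dihedral_level_def)
qed

text \<open>After the descent \<open>c\<close> is stripped, the next descent must be the other
  generator. Thus a reduced word alternates and is determined by its length and last letter.\<close>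

lemma dihedral_level_descent_unique:
  assumes "s \<in> S" "t \<in> S"
  shows "v \<in> dihedral_level s t n \<Longrightarrow> w \<in> dihedral_level s t n \<Longrightarrow> c \<in> {s, t} \<Longrightarrow>
    cox_length (v \<otimes> c) < cox_length v \<Longrightarrow> cox_length (w \<otimes> c) < cox_length w \<Longrightarrow> v = w"
proof (induction n arbitrary: v w c)
  case 0
  then show ?case using dihedral_level_0[OF assms] by simp
next
  case (Suc n)
  have c: "c \<in> S" using Suc.prems(3) assms by blast
  note vw = dihedral_level_closed[OF assms Suc.prems(1)] dihedral_level_closed[OF assms Suc.prems(2)]
  note vwc = dihedral_level_mult_descent[OF assms Suc.prems(1,3,4)]
    dihedral_level_mult_descent[OF assms Suc.prems(2,3,5)]
  have "v \<otimes> c = w \<otimes> c"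
  proof (cases n)
    case 0
    then show ?thesis using vwc dihedral_level_0[OF assms] by simp
  next
    case (Suc m)
    have *: "\<exists>d \<in> {s, t} - {c}. cox_length (x \<otimes> c \<otimes> d) < cox_length (x \<otimes> c)"
      if x: "x \<in> carrier W" "cox_length (x \<otimes> c) < cox_length x" "x \<otimes> c \<in> dihedral_level s t n" for x
    proof -
      obtain d where d: "d \<in> {s, t}" "covered_by (x \<otimes> c \<otimes> d) (x \<otimes> c)"
        using dihedral_level_ex_descent[OF assms, of "x \<otimes> c" m] x(3) Suc by blast
      then have less: "cox_length (x \<otimes> c \<otimes> d) < cox_length (x \<otimes> c)"
        using covered_by_length by simp
      then have "d \<noteq> c" using x(1,2) c by (metis gen_cancel_right not_less_iff_gr_or_eq)
      then show ?thesis using d(1) less by blast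
    qed
    obtain d where d: "d \<in> {s, t} - {c}" "cox_length (v \<otimes> c \<otimes> d) < cox_length (v \<otimes> c)"
      using *[OF vw(1) Suc.prems(4) vwc(1)] by blast
    obtain e where e: "e \<in> {s, t} - {c}" "cox_length (w \<otimes> c \<otimes> e) < cox_length (w \<otimes> c)"
      using *[OF vw(2) Suc.prems(5) vwc(2)] by blast
    have "d = e" using d(1) e(1) Suc.prems(3) by blast
    then show ?thesis using Suc.IH[OF vwc, of d] d e by blast
  qed
  then show ?case using vw c by simp
qed

text \<open>Pigeonhole: above the bottom level, three elements have descents among only two
  generators.\<close>

lemma dihedral_level_card:
  assumes "s \<in> S" "t \<in> S" "u \<in> dihedral_level s t n" "v \<in> dihedral_level s t n"
    "w \<in> dihedral_level s t n"
  shows "u = v \<or> u = w \<or> v = w"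
proof (cases n)
  case 0
  then show ?thesis using dihedral_level_0 assms by auto
next
  case (Suc m)
  have *: "\<exists>c \<in> {s, t}. cox_length (x \<otimes> c) < cox_length x" if x: "x \<in> dihedral_level s t n" for x
  proof -
    obtain c where "c \<in> {s, t}" "covered_by (x \<otimes> c) x"
      using dihedral_level_ex_descent[OF assms(1,2), of x m] x Suc by blast
    then show ?thesis using covered_by_length[of "x \<otimes> c" x] by auto
  qed
  obtain c where c: "c \<in> {s, t}" "cox_length (u \<otimes> c) < cox_length u" using *[OF assms(3)] by blast
  obtain d where d: "d \<in> {s, t}" "cox_length (v \<otimes> d) < cox_length v" using *[OF assms(4)] by blast
  obtain e where e: "e \<in> {s, t}" "cox_length (w \<otimes> e) < cox_length w" using *[OF assms(5)] by blast
  consider "c = d" | "c = e" | "d = e" using c(1) d(1) e(1) by blast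
  then show ?thesis
    using c d e assms dihedral_level_descent_unique[OF assms(1,2)] by cases blast+
qed

lemma dihedral_level_Suc_two:
  assumes "s \<in> S" "t \<in> S" "n > 0" "z \<in> dihedral_level s t (Suc n)"
  obtains u v where "u \<in> dihedral_level s t n" "v \<in> dihedral_level s t n" "u \<noteq> v"
    "covered_by u z" "covered_by v z"
proof -
  obtain c where c: "z \<otimes> c \<in> dihedral_level s t n" "covered_by (z \<otimes> c) z"
    using dihedral_level_ex_descent[OF assms(1,2,4)] by blast
  have "z \<otimes> c \<noteq> \<one>" using c(1) assms(3) by (auto dest: dihedral_level_length)
  then have "coat z \<noteq> {z \<otimes> c}" using coat_singleton by blast
  then obtain v where v: "covered_by v z" "v \<noteq> z \<otimes> c"
    using c(2) by (auto simp: coat_def)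
  then have "v \<in> dihedral_level s t n"
    using decreasing_generateD[of "{s, t}" z v] covered_by_length[OF v(1)] assms
    by (auto simp: dihedral_level_def)
  then show ?thesis using that c v by blast
qed

text \<open>The coatoms lie in the previous level, which has at most two elements; by
  \<open>coat_singleton\<close> there are two of them unless that level is the bottom one. So inside
  the subgroup the Bruhat order compares lengths only.\<close>

lemma coat_dihedral:
  assumes "s \<in> S" "t \<in> S" "z \<in> dihedral_level s t (Suc n)"
  shows "coat z = dihedral_level s t n"
proof
  show "coat z \<subseteq> dihedral_level s t n"
    using decreasing_generateD[of "{s, t}" z] covered_by_length[of _ z] assms
    by (auto simp: dihedral_level_def coat_def)
  show "dihedral_level s t n \<subseteq> coat z"
  proof (cases n)
    case 0
    then obtain c where "z \<otimes> c \<in> dihedral_level s t 0" "covered_by (z \<otimes> c) z"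
      using dihedral_level_ex_descent[OF assms] by blast
    then show ?thesis using 0 dihedral_level_0[OF assms(1,2)] by (simp add: coat_iff)
  next
    case (Suc m)
    then obtain u v where "u \<in> dihedral_level s t n" "v \<in> dihedral_level s t n" "u \<noteq> v"
      "covered_by u z" "covered_by v z"
      using dihedral_level_Suc_two[OF assms(1,2) _ assms(3)] by blast
    then show ?thesis using dihedral_level_card[OF assms(1,2)] unfolding coat_def by blast
  qed
qed

text \<open>Two elements of one level share no descent, so a descent of \<open>y\<close> is an
  ascent of \<open>x\<close> and leads to the next level.\<close>

lemma dihedral_level_Suc_nonempty:
  assumes "s \<in> S" "t \<in> S" "x \<in> dihedral_level s t n" "y \<in> dihedral_level s t n" "x \<noteq> y"
  shows "dihedral_level s t (Suc n) \<noteq> {}"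
proof -
  have "n \<noteq> 0"
    using assms(3-5) dihedral_level_0[OF assms(1,2)] by (intro notI) simp
  then obtain m where "n = Suc m" using not0_implies_Suc by blast
  then obtain c where c: "c \<in> {s, t}" "covered_by (y \<otimes> c) y"
    using dihedral_level_ex_descent[OF assms(1,2), of y m] assms(4) by blast
  then have "\<not> cox_length (x \<otimes> c) < cox_length x"
    using dihedral_level_descent_unique[OF assms(1-4) c(1)] assms(5) covered_by_length[OF c(2)] by auto
  moreover have cS: "c \<in> S" and x: "x \<in> carrier W"
    using c assms dihedral_level_closed by auto
  ultimately have "cox_length (x \<otimes> c) = Suc n"
    using dihedral_level_length[OF assms(3)] by (cases rule: cox_length_gen_cases[OF x cS]) auto
  moreover have "x \<otimes> c \<in> generate W {s, t}"
    using generate_mult_gen_iff[of "{s, t}" c x] c x assms(1-3) by (auto simp: dihedral_level_def)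
  ultimately show ?thesis by (auto simp: dihedral_level_def)
qed

section \<open>Matchings\<close>

lemma matchingD:
  assumes "partial_distinguished_matching (Q, \<phi>)"
  shows "decreasing Q" "\<phi> \<in> Q \<rightarrow>\<^sub>E Q"
    "\<And>u. u \<in> Q \<Longrightarrow> \<phi> u \<in> Q" "\<And>u. u \<in> Q \<Longrightarrow> \<phi> (\<phi> u) = u"
    "\<And>u. u \<in> Q \<Longrightarrow> covered_by u (\<phi> u) \<or> covered_by (\<phi> u) u"
    "\<And>u. u \<in> Q \<Longrightarrow> covered_by u (\<phi> u) \<Longrightarrow>
      coat (\<phi> u) = {u} \<union> {\<phi> v | v. covered_by v u \<and> covered_by v (\<phi> v)}"
  using assms unfolding partial_distinguished_matching_def prod.case by blast+

lemma matchingI: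
  assumes "decreasing Q" "\<phi> \<in> Q \<rightarrow>\<^sub>E Q" "\<And>u. u \<in> Q \<Longrightarrow> \<phi> (\<phi> u) = u"
    "\<And>u. u \<in> Q \<Longrightarrow> covered_by u (\<phi> u) \<or> covered_by (\<phi> u) u"
    "\<And>u. u \<in> Q \<Longrightarrow> covered_by u (\<phi> u) \<Longrightarrow>
      coat (\<phi> u) = {u} \<union> {\<phi> v | v. covered_by v u \<and> covered_by v (\<phi> v)}"
  shows "partial_distinguished_matching (Q, \<phi>)"
  using assms unfolding partial_distinguished_matching_def prod.case by blast

lemma decreasing_closed: "decreasing Q \<Longrightarrow> u \<in> Q \<Longrightarrow> u \<in> carrier W"
  by (auto simp: decreasing_def)

lemma decreasing_covered_by: "decreasing Q \<Longrightarrow> u \<in> Q \<Longrightarrow> covered_by v u \<Longrightarrow> v \<in> Q"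
  by (auto simp: decreasing_def covered_by_iff)

lemma one_bruhat_le:
  assumes "w \<in> carrier W"
  shows "bruhat_le \<one> w"
  using assms
proof (induction "cox_length w" arbitrary: w rule: less_induct)
  case less
  show ?case
  proof (cases "w = \<one>")
    case False
    then obtain s where s: "s \<in> S" "cox_length (w \<otimes> s) < cox_length w"
      using ex_right_descent less by blast
    then have "bruhat_le \<one> (w \<otimes> s)" using less by simp
    then show ?thesis using bruhat_le_gen less(2) s bruhat_le_trans by blast
  qed simp
qed

lemma one_in_decreasing: "decreasing Q \<Longrightarrow> u \<in> Q \<Longrightarrow> \<one> \<in> Q"
  using one_bruhat_le unfolding decreasing_def by blast

lemma covered_by_one: "\<not> covered_by u \<one>"
  using covered_by_length[of u \<one>] by auto

lemma covered_by_one_gen: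
  assumes "s \<in> S"
  shows "covered_by \<one> s"
  using descent_covered_by[of s s] cox_length_gen assms by simp

lemma coat_gen:
  assumes "s \<in> S"
  shows "coat s = {\<one>}"
proof -
  have "covered_by u s \<longleftrightarrow> u = \<one>" for u
    using covered_by_one_gen[OF assms] covered_by_length[of u s] covered_by_closed[of u s]
      cox_length_eq_0[of u] cox_length_gen[OF assms] by auto
  then show ?thesis by (simp add: coat_def)
qed

lemma matching_one_gen:
  assumes "partial_distinguished_matching (Q, \<phi>)" "\<one> \<in> Q"
  shows "covered_by \<one> (\<phi> \<one>)" "\<phi> \<one> \<in> S"
proof -
  show c: "covered_by \<one> (\<phi> \<one>)" using matchingD(5)[OF assms] covered_by_one by blast
  then show "\<phi> \<one> \<in> S"
    using covered_by_length[OF c] covered_by_closed[OF c] by (intro gen_if_cox_length_1) simp_all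
qed

text \<open>The coatoms of an upward value \<open>\<phi> u\<close> are \<open>u\<close> and values
  of \<open>\<phi>\<close> at shorter elements of the subgroup, so \<open>generate_if_coat\<close>
  applies. Only \<open>u = \<one>\<close> is out of its reach, and there the hypothesis
  \<open>\<phi> \<one> \<in> J\<close> takes over.\<close>

lemma matching_stable_generate:
  assumes M: "partial_distinguished_matching (Q, \<phi>)" and J: "J \<subseteq> S" "\<phi> \<one> \<in> J"
  shows "u \<in> Q \<Longrightarrow> u \<in> generate W J \<Longrightarrow> \<phi> u \<in> generate W J"
proof (induction "cox_length u" arbitrary: u rule: less_induct)
  case less
  note u = less(2,3)
  from matchingD(5)[OF M u(1)] show ?case
  proof
    assume "covered_by (\<phi> u) u"
    then show ?thesis using decreasing_generateD[OF J(1) u(2)] by blast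
  next
    assume up: "covered_by u (\<phi> u)"
    note c = covered_by_closed[OF up]
    show ?thesis
    proof (cases "u = \<one>")
      case True
      then show ?thesis using J(2) by (simp add: generate.incl)
    next
      case False
      have "coat (\<phi> u) \<subseteq> generate W J"
      proof
        fix x assume "x \<in> coat (\<phi> u)"
        then consider "x = u" | v where "x = \<phi> v" "covered_by v u"
          using matchingD(6)[OF M u(1) up] by blast
        then show "x \<in> generate W J"
        proof cases
          case 2
          have "v \<in> Q" "v \<in> generate W J" "cox_length v < cox_length u"
            using decreasing_covered_by[OF matchingD(1)[OF M] u(1) 2(2)]
              decreasing_generateD[OF J(1) u(2) 2(2)] covered_by_length[OF 2(2)] by simp_all
          then show ?thesis using less(1) 2(1) by blast
        qed (use u in simp)
      qed
      moreover have "cox_length u \<noteq> 0" using False cox_length_eq_0[OF c(1)] by simp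
      then have "2 \<le> cox_length (\<phi> u)" using covered_by_length[OF up] by simp
      ultimately show ?thesis using generate_if_coat[OF J(1) c(2)] by blast
    qed
  qed
qed

text \<open>If \<open>x\<close> is matched downwards, but not with \<open>\<one>\<close>, its
  partner is not its only coatom by \<open>coat_singleton\<close>. Hence some
  \<open>\<phi> v\<close> is a coatom too, again matched downwards and shorter. The descent ends at
  \<open>\<phi> \<one>\<close> and never leaves the decreasing subgroup.\<close>

lemma matching_down_generate:
  assumes M: "partial_distinguished_matching (Q, \<phi>)" and J: "J \<subseteq> S"
  shows "x \<in> Q \<Longrightarrow> covered_by (\<phi> x) x \<Longrightarrow> x \<in> generate W J \<Longrightarrow> \<phi> \<one> \<in> generate W J"
proof (induction "cox_length x" arbitrary: x rule: less_induct)
  case less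
  note D = matchingD[OF M]
  let ?u = "\<phi> x"
  have u: "?u \<in> Q" "\<phi> ?u = x" using D(3,4) less by blast+
  show ?case
  proof (cases "?u = \<one>")
    case True
    then show ?thesis using u(2) less(4) by simp
  next
    case False
    have coat: "coat x = {?u} \<union> {\<phi> v | v. covered_by v ?u \<and> covered_by v (\<phi> v)}"
      using D(6)[OF u(1)] u(2) less(3) by simp
    moreover have "coat x \<noteq> {?u}" using coat_singleton False by blast
    ultimately obtain v where v: "covered_by v ?u" "covered_by v (\<phi> v)" by blast
    have vQ: "v \<in> Q" using decreasing_covered_by[OF D(1) u(1) v(1)] .
    have vx: "covered_by (\<phi> v) x" using coat v by (auto simp: coat_iff[symmetric])
    have "\<phi> v \<in> Q" "\<phi> v \<in> generate W J" "covered_by (\<phi> (\<phi> v)) (\<phi> v)"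
      using D(3,4) vQ v(2) decreasing_generateD[OF J less(4) vx] by simp_all
    then show ?thesis using less(1)[of "\<phi> v"] covered_by_length[OF vx] by simp
  qed
qed

lemma matchings_agree:
  assumes M: "partial_distinguished_matching (Q, \<phi>)" "partial_distinguished_matching (R, \<psi>)"
    and one: "\<phi> \<one> = a" "a \<in> S"
    and agree: "\<And>s u. s \<in> S - {a} \<Longrightarrow> u \<in> generate W {s, a} \<Longrightarrow> \<phi> u = \<psi> u"
  shows "u \<in> Q \<Longrightarrow> u \<in> R \<Longrightarrow> \<phi> u = \<psi> u"
proof (induction "cox_length u" arbitrary: u rule: less_induct)
  case less
  note D = matchingD[OF M(1)] and E = matchingD[OF M(2)]
  have low: "\<phi> v = \<psi> v" if "covered_by v u" for v
    using less(1)[of v] decreasing_covered_by[OF D(1) less(2) that]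
      decreasing_covered_by[OF E(1) less(3) that] covered_by_length[OF that] by simp
  consider "covered_by (\<phi> u) u" | "covered_by (\<psi> u) u"
    | "covered_by u (\<phi> u)" "covered_by u (\<psi> u)"
    using D(5)[OF less(2)] E(5)[OF less(3)] by blast
  then show ?case
  proof cases
    \<comment> \<open>A downward partner is shorter than \<open>u\<close>, so both maps agree on it,
      and the involution carries the equality back to \<open>u\<close>.\<close>
    case 1
    then have "\<psi> (\<phi> u) = u" "\<phi> u \<in> R"
      using low[OF 1] D(4)[OF less(2)] decreasing_covered_by[OF E(1) less(3)] by simp_all
    then show ?thesis using E(4)[of "\<phi> u"] by simp
  next
    case 2
    then have "\<phi> (\<psi> u) = u" "\<psi> u \<in> Q"
      using low[OF 2] E(4)[OF less(3)] decreasing_covered_by[OF D(1) less(2)] by simp_all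
    then show ?thesis using D(4)[of "\<psi> u"] by simp
  next
    case 3
    note c = covered_by_closed[OF 3(1)] covered_by_closed(2)[OF 3(2)]
    have "{\<phi> v | v. covered_by v u \<and> covered_by v (\<phi> v)} = {\<psi> v | v. covered_by v u \<and> covered_by v (\<psi> v)}"
      using low by metis
    then have coat: "coat (\<phi> u) = coat (\<psi> u)"
      using D(6)[OF less(2) 3(1)] E(6)[OF less(3) 3(2)] by simp
    have "\<phi> u \<noteq> \<one>" "\<psi> u \<noteq> \<one>" using 3 covered_by_one by metis+
    then obtain s t where s: "s \<in> S" "cox_length (\<phi> u \<otimes> s) < cox_length (\<phi> u)"
      and t: "t \<in> S" "cox_length (\<psi> u \<otimes> t) < cox_length (\<psi> u)"
      using ex_right_descent c by metis
    have "\<phi> u = \<psi> u \<or> s \<noteq> t \<and> \<phi> u \<in> generate W {s, t}"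
      using coat_eq_cases[OF coat c(2,3) s(1) t(1) s(2) t(2)] .
    then show ?thesis
    proof
      assume g: "s \<noteq> t \<and> \<phi> u \<in> generate W {s, t}"
      have J: "{s, t} \<subseteq> S" using s t by simp
      \<comment> \<open>\<open>\<phi> u\<close> is matched downwards with \<open>u\<close>, so the
        dihedral subgroup around it contains \<open>a\<close>, and the agreement hypothesis becomes
        applicable.\<close>
      have "\<phi> \<one> \<in> generate W {s, t}"
        using matching_down_generate[OF M(1) J, of "\<phi> u"] D(3,4)[OF less(2)] 3(1) g by simp
      then have a: "a \<in> {s, t}" using gen_in_generate_iff[OF J one(2)] one(1) by simp
      have "u \<in> generate W {s, t}" using decreasing_generateD[OF J] g 3(1) by blast
      then show ?thesis using agree[of s u] agree[of t u] a g s(1) t(1) by (auto simp: insert_commute)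
    qed
  qed
qed

section \<open>Restriction of matchings and extension by one pair\<close>

lemma matching_restrict:
  assumes M: "partial_distinguished_matching (Q, \<phi>)" and A: "A \<subseteq> Q" "decreasing A"
    and stable: "\<And>u. u \<in> A \<Longrightarrow> \<phi> u \<in> A"
  shows "partial_distinguished_matching (A, restrict \<phi> A)"
proof (rule matchingI)
  note D = matchingD[OF M]
  fix u assume u: "u \<in> A"
  then have Q: "u \<in> Q" using A by blast
  show "restrict \<phi> A (restrict \<phi> A u) = u" using u Q stable D(4) by simp
  show "covered_by u (restrict \<phi> A u) \<or> covered_by (restrict \<phi> A u) u" using u D(5)[OF Q] by simp
  assume "covered_by u (restrict \<phi> A u)"
  then have "coat (\<phi> u) = {u} \<union> {\<phi> v | v. covered_by v u \<and> covered_by v (\<phi> v)}"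
    using u D(6)[OF Q] by simp
  moreover have "restrict \<phi> A v = \<phi> v" if "covered_by v u" for v
    using decreasing_covered_by[OF A(2) u that] by simp
  then have "{\<phi> v | v. covered_by v u \<and> covered_by v (\<phi> v)} =
      {restrict \<phi> A v | v. covered_by v u \<and> covered_by v (restrict \<phi> A v)}" by metis
  ultimately show "coat (restrict \<phi> A u) =
      {u} \<union> {restrict \<phi> A v | v. covered_by v u \<and> covered_by v (restrict \<phi> A v)}"
    using u by simp
qed (use A stable in auto)

text \<open>The equation \<open>coat_z\<close> is the coatom condition for the new pair. Knowing
  where the coatoms of \<open>y\<close> and \<open>z\<close> lie is enough to see that the enlarged
  domain is decreasing, because everything strictly below an element is below one of its
  coatoms.\<close>

lemma matching_extend:
  assumes M: "partial_distinguished_matching (Q, \<phi>)" and new: "y \<notin> Q" "z \<notin> Q"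
    and yz: "covered_by y z" and y: "coat y \<subseteq> Q" and z: "coat z \<subseteq> insert y Q"
    and coat_z: "coat z = {y} \<union> {\<phi> v | v. covered_by v y \<and> covered_by v (\<phi> v)}"
  shows "partial_distinguished_matching (insert y (insert z Q), \<phi>(y := z, z := y))"
    (is "partial_distinguished_matching (?R, ?\<psi>)")
proof (rule matchingI)
  note D = matchingD[OF M]
  have neq: "y \<noteq> z" using covered_by_length[OF yz] by auto
  have \<psi>: "?\<psi> y = z" "?\<psi> z = y" "\<And>u. u \<in> Q \<Longrightarrow> ?\<psi> u = \<phi> u" using neq new by auto
  have below_y: "x \<in> insert y Q" if "bruhat_le x y" for x
    using bruhat_le_coat[OF that] y D(1) by (auto simp: decreasing_def)
  have below_z: "x \<in> ?R" if le: "bruhat_le x z" for x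
  proof -
    consider "x = z" | w where "w \<in> insert y Q" "bruhat_le x w"
      using bruhat_le_coat[OF le] z by blast
    then show ?thesis using below_y D(1) by cases (auto simp: decreasing_def)
  qed
  show "decreasing ?R"
    using D(1) covered_by_closed[OF yz] below_y below_z by (auto simp: decreasing_def)
  show "?\<psi> \<in> ?R \<rightarrow>\<^sub>E ?R" using D(2) new neq by (auto simp: PiE_def extensional_def)
  fix u assume "u \<in> ?R"
  then consider "u = y" | "u = z" | "u \<in> Q" by blast
  note cases = this
  show "?\<psi> (?\<psi> u) = u" using cases D(3,4) \<psi> by cases simp_all
  show "covered_by u (?\<psi> u) \<or> covered_by (?\<psi> u) u" using cases D(5) \<psi> yz by cases simp_all
  \<comment> \<open>The coatom condition at \<open>w\<close> evaluates the map only at coatoms of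
    \<open>w\<close>; when these are old, the update is invisible.\<close>
  have eq: "{?\<psi> v | v. covered_by v w \<and> covered_by v (?\<psi> v)} = {\<phi> v | v. covered_by v w \<and> covered_by v (\<phi> v)}"
    if "coat w \<subseteq> Q" for w
  proof -
    have "?\<psi> v = \<phi> v" if "covered_by v w" for v
    proof (rule \<psi>(3))
      show "v \<in> Q" using \<open>coat w \<subseteq> Q\<close> that unfolding coat_def by blast
    qed
    then show ?thesis by metis
  qed
  assume up: "covered_by u (?\<psi> u)"
  from cases show "coat (?\<psi> u) = {u} \<union> {?\<psi> v | v. covered_by v u \<and> covered_by v (?\<psi> v)}"
  proof cases
    case 1
    show ?thesis unfolding 1 \<psi> eq[OF y] by (rule coat_z)
  next
    case 2
    then have False using up yz covered_by_asym \<psi> by metis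
    then show ?thesis ..
  next
    case 3
    have "coat u \<subseteq> Q" using decreasing_covered_by[OF D(1) 3] by (auto simp: coat_iff)
    show ?thesis unfolding eq[OF \<open>coat u \<subseteq> Q\<close>] \<psi>(3)[OF 3] using D(6)[OF 3] up \<psi>(3)[OF 3] by simp
  qed
qed

text \<open>If a further level exists, a level above the bottom has two elements: one is the partner
  of the unique upward element below, and the other cannot go down as well. Nonemptiness of the next
  level rules out the longest element of a finite subgroup, which is matched downwards.\<close>

lemma dihedral_ex1_up:
  assumes M: "partial_distinguished_matching (Q, \<phi>)" and one: "\<one> \<in> Q" "\<phi> \<one> = a" and s: "s \<in> S"
  shows "(\<And>i. i \<le> n \<Longrightarrow> dihedral_level s a i \<subseteq> Q) \<Longrightarrow> dihedral_level s a (Suc n) \<noteq> {} \<Longrightarrow>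
    \<exists>!v. v \<in> dihedral_level s a n \<and> covered_by v (\<phi> v)"
proof (induction n)
  note D = matchingD[OF M]
  have a: "a \<in> S" "covered_by \<one> (\<phi> \<one>)" using matching_one_gen[OF M one(1)] one(2) by auto
  note L0 = dihedral_level_0[OF s a(1)]
  {
    case 0
    show ?case unfolding L0 using a(2) by blast
  next
    case (Suc n)
    let ?L = "dihedral_level s a"
    obtain z where "z \<in> ?L (Suc (Suc n))" using Suc.prems(2) by blast
    then obtain p q where pq: "p \<in> ?L (Suc n)" "q \<in> ?L (Suc n)" "p \<noteq> q"
      using dihedral_level_Suc_two[OF s a(1), of "Suc n" z] by blast
    then have "\<exists>!v. v \<in> ?L n \<and> covered_by v (\<phi> v)"
      using Suc.prems(1) by (intro Suc.IH) auto
    then obtain v where v: "v \<in> ?L n" "covered_by v (\<phi> v)"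
      and v_unique: "\<And>w. w \<in> ?L n \<Longrightarrow> covered_by w (\<phi> w) \<Longrightarrow> w = v" by blast
    have vQ: "v \<in> Q" using v(1) Suc.prems(1)[of n] by auto
    have x: "\<phi> v \<in> ?L (Suc n)"
      using matching_stable_generate[OF M, of "{s, a}" v] s a one(2) vQ v covered_by_length[OF v(2)]
      by (simp add: dihedral_level_def)
    \<comment> \<open>A downward partner of \<open>w\<close> would be an upward element one level
      below, hence \<open>v\<close>, which is already taken by \<open>\<phi> v\<close>.\<close>
    have up: "covered_by w (\<phi> w) \<longleftrightarrow> w \<noteq> \<phi> v" if w: "w \<in> ?L (Suc n)" for w
    proof -
      have wQ: "w \<in> Q" using w Suc.prems(1)[of "Suc n"] by auto
      have "\<phi> w \<in> ?L n" if "covered_by (\<phi> w) w"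
        using that coat_dihedral[OF s a(1) w] by (simp add: coat_iff[symmetric])
      then have "w = \<phi> v" if "covered_by (\<phi> w) w"
        using v_unique[of "\<phi> w"] that D(4)[OF wQ] by simp
      moreover have "\<not> covered_by (\<phi> v) (\<phi> (\<phi> v))"
        using D(4)[OF vQ] v(2) covered_by_asym by simp
      ultimately show ?thesis using D(5)[OF wQ] by blast
    qed
    obtain w where w: "w \<in> ?L (Suc n)" "w \<noteq> \<phi> v" using pq by blast
    show ?case
    proof (rule ex1I[of _ w])
      show "w \<in> ?L (Suc n) \<and> covered_by w (\<phi> w)" using up w by blast
      fix u assume "u \<in> ?L (Suc n) \<and> covered_by u (\<phi> u)"
      then show "u = w" using up w x dihedral_level_card[OF s a(1)] by metis
    qed
  }
qed

lemma maximal_matchingD: "maximal_distinguished_matching M \<Longrightarrow> partial_distinguished_matching M"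
  by (simp add: maximal_distinguished_matching_def)

lemma maximal_matching_not_extended:
  assumes "maximal_distinguished_matching (Q, \<phi>)" "partial_distinguished_matching (R, \<psi>)"
    and "Q \<subset> R"
  shows "\<exists>u \<in> Q. \<psi> u \<noteq> \<phi> u"
  using assms unfolding maximal_distinguished_matching_def matching_le_def by fastforce

text \<open>
  If $P$ is not contained in $Q$, the first level of $P$ not contained in $Q$ is $\{x, y\}$ with
  $x \in Q$ and $y \notin Q$. Then $y$ can be matched with any $z$ in the next level: the only
  element of the previous level that is matched upwards is $\phi(x)$.
\<close>
lemma maximal_matching_dihedral:
  assumes max: "maximal_distinguished_matching (Q, \<phi>)" and one: "\<one> \<in> Q" "\<phi> \<one> = a"
    and s: "s \<in> S"
  shows "generate W {s, a} \<subseteq> Q"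
proof (rule ccontr)
  assume not: "\<not> ?thesis"
  note M = maximal_matchingD[OF max]
  note D = matchingD[OF M]
  let ?L = "dihedral_level s a"
  have a: "a \<in> S" using matching_one_gen[OF M one(1)] one(2) by auto
  obtain w where w: "w \<in> generate W {s, a}" "w \<notin> Q" using not by blast
  define k where "k = (LEAST i. \<not> ?L i \<subseteq> Q)"
  have "\<not> ?L (cox_length w) \<subseteq> Q" using w by (auto simp: dihedral_level_def)
  then have "\<not> ?L k \<subseteq> Q" unfolding k_def by (rule LeastI)
  then obtain y where y: "y \<in> ?L k" "y \<notin> Q" by blast
  have below: "?L i \<subseteq> Q" if "i < k" for i
    using not_less_Least[OF that[unfolded k_def]] by simp
  have "k \<noteq> 0" using y one(1) dihedral_level_0[OF s a] by (intro notI) simp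
  then obtain j where k: "k = Suc j" using not0_implies_Suc by blast
  have "\<exists>!v. v \<in> ?L j \<and> covered_by v (\<phi> v)"
    using dihedral_ex1_up[OF M one s, of j] below y(1) k by (metis empty_iff less_Suc_eq_le)
  then obtain v where v: "v \<in> ?L j" "covered_by v (\<phi> v)"
    and v_unique: "\<And>w. w \<in> ?L j \<Longrightarrow> covered_by w (\<phi> w) \<Longrightarrow> w = v" by blast
  have vQ: "v \<in> Q" using v(1) below[of j] k by auto
  have x: "\<phi> v \<in> ?L k"
    using matching_stable_generate[OF M, of "{s, a}" v] s a one(2) vQ v k covered_by_length[OF v(2)]
    by (simp add: dihedral_level_def)
  have xy: "\<phi> v \<noteq> y" using D(3)[OF vQ] y(2) by blast
  \<comment> \<open>Level \<open>k\<close> has the two distinct members \<open>\<phi> v\<close> and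
    \<open>y\<close>, so it is not the top level and \<open>z\<close> exists.\<close>
  obtain z where z: "z \<in> ?L (Suc k)"
    using dihedral_level_Suc_nonempty[OF s a x y(1) xy] by blast
  have "u = y \<or> u = \<phi> v" if "u \<in> ?L k" for u
    using dihedral_level_card[OF s a that y(1) x] xy by auto
  then have Lk: "?L k = {y, \<phi> v}" using x y(1) by blast
  have coat_z: "coat z = {y, \<phi> v}" using coat_dihedral[OF s a z] Lk by simp
  then have yz: "covered_by y z" by (auto simp: coat_iff[symmetric])
  then have zQ: "z \<notin> Q" using decreasing_covered_by[OF D(1)] y(2) by blast
  have coat_y: "coat y = ?L j" using coat_dihedral[OF s a] y(1) k by blast
  have "covered_by u y \<and> covered_by u (\<phi> u) \<longleftrightarrow> u = v" for u
    using coat_y v v_unique unfolding coat_def by blast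
  then have coat_z': "coat z = {y} \<union> {\<phi> u | u. covered_by u y \<and> covered_by u (\<phi> u)}"
    using coat_z by (simp add: insert_commute)
  have coats: "coat y \<subseteq> Q" "coat z \<subseteq> insert y Q"
    using coat_y below[of j] k coat_z D(3)[OF vQ] by simp_all
  have "\<exists>u \<in> Q. (\<phi>(y := z, z := y)) u \<noteq> \<phi> u"
    using y(2) by (intro maximal_matching_not_extended[OF max
      matching_extend[OF M y(2) zQ yz coats coat_z']]) blast
  then show False using y(2) zQ by (metis fun_upd_other)
qed

text \<open>It shows that the empty matching is not maximal when there are generators, and it fixes
  the value at \<open>\<one>\<close> when \<open>S = {a}\<close> and no \<open>\<alpha> s\<close> is
  available.\<close>

definition gen_matching :: "'a \<Rightarrow> 'a set \<times> ('a \<Rightarrow> 'a)" where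
  "gen_matching a = ({\<one>, a}, (\<lambda>_. undefined)(\<one> := a, a := \<one>))"

lemma gen_matching:
  assumes "a \<in> S"
  shows "partial_distinguished_matching (gen_matching a)"
proof -
  have "partial_distinguished_matching ({}, \<lambda>_. undefined)"
    by (rule matchingI) (auto simp: decreasing_def)
  then have "partial_distinguished_matching (insert \<one> (insert a {}), (\<lambda>_. undefined)(\<one> := a, a := \<one>))"
    using covered_by_one_gen[OF assms] coat_gen[OF assms] covered_by_one
    by (intro matching_extend) (auto simp: coat_def)
  then show ?thesis by (simp add: gen_matching_def)
qed

lemma maximal_matching_one:
  assumes max: "maximal_distinguished_matching (Q, \<phi>)" and "S \<noteq> {}"
  shows "\<one> \<in> Q"
proof (rule ccontr)
  assume "\<one> \<notin> Q"
  then have "Q = {}" using one_in_decreasing matchingD(1)[OF maximal_matchingD[OF max]] by blast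
  moreover obtain a where "a \<in> S" using assms(2) by blast
  then have "partial_distinguished_matching (gen_matching a)" by (rule gen_matching)
  ultimately show False
    using maximal_matching_not_extended[OF max] unfolding gen_matching_def by blast
qed

theorem maximal_matching_restrict_dihedral:
  assumes max: "maximal_distinguished_matching (Q, \<phi>)" and a: "a = \<phi> \<one>" and s: "s \<in> S"
  shows "generate W {s, a} \<subseteq> Q" "\<phi> ` generate W {s, a} \<subseteq> generate W {s, a}"
    "distinguished_matching_on (generate W {s, a}) (restrict \<phi> (generate W {s, a}))"
proof -
  note M = maximal_matchingD[OF max]
  have one: "\<one> \<in> Q" using maximal_matching_one[OF max] s by blast
  then have J: "{s, a} \<subseteq> S" using matching_one_gen[OF M] s a by simp
  show sub: "generate W {s, a} \<subseteq> Q" using maximal_matching_dihedral[OF max one a[symmetric] s] .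
  have st: "\<phi> u \<in> generate W {s, a}" if "u \<in> generate W {s, a}" for u
    using that sub by (intro matching_stable_generate[OF M J]) (auto simp: a)
  then show "\<phi> ` generate W {s, a} \<subseteq> generate W {s, a}" by blast
  show "distinguished_matching_on (generate W {s, a}) (restrict \<phi> (generate W {s, a}))"
    using matching_restrict[OF M sub decreasing_generate[OF J] st] decreasing_generate[OF J]
    by (simp add: distinguished_matching_on_def)
qed

section \<open>Gluing\<close>

definition compatible :: "('a set \<times> ('a \<Rightarrow> 'a)) set \<Rightarrow> bool" where
  "compatible F \<longleftrightarrow> (\<forall>M \<in> F. \<forall>N \<in> F. \<forall>x \<in> fst M \<inter> fst N. snd M x = snd N x)"

text \<open>Which member is chosen for \<open>x\<close> does not matter once \<open>F\<close> is
  \<open>compatible\<close>. The restriction makes the map \<open>undefined\<close> outside the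
  union, as the encoding of partial maps demands.\<close>

definition glue :: "('a set \<times> ('a \<Rightarrow> 'a)) set \<Rightarrow> 'a set \<times> ('a \<Rightarrow> 'a)" where
  "glue F = (\<Union>(fst ` F), \<lambda>x\<in>\<Union>(fst ` F). snd (SOME M. M \<in> F \<and> x \<in> fst M) x)"

lemma fst_glue: "fst (glue F) = \<Union>(fst ` F)"
  by (simp add: glue_def)

lemma glue_apply:
  assumes F: "compatible F" and M: "M \<in> F" "x \<in> fst M"
  shows "snd (glue F) x = snd M x"
proof -
  define N where "N = (SOME M. M \<in> F \<and> x \<in> fst M)"
  have "N \<in> F \<and> x \<in> fst N" unfolding N_def by (rule someI[where x = M]) (use M in blast)
  then have "snd N x = snd M x" using F M unfolding compatible_def by (meson IntI)
  moreover have "x \<in> \<Union>(fst ` F)" using M by blast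
  then have "snd (glue F) x = snd N x" by (simp only: glue_def snd_conv restrict_apply' N_def)
  ultimately show ?thesis by (simp only:)
qed

lemma matching_le_glue:
  assumes "compatible F" "M \<in> F"
  shows "matching_le M (glue F)"
  using glue_apply[OF assms] assms(2) unfolding matching_le_def fst_glue by blast

text \<open>The conditions at \<open>u\<close> evaluate the map only at \<open>u\<close>, its
  partner and its coatoms. All of these lie in the domain of any single member containing
  \<open>u\<close>, since that domain is stable and decreasing, so the conditions are inherited from
  that member.\<close>

lemma matching_glue:
  assumes F: "compatible F" and M: "\<And>M. M \<in> F \<Longrightarrow> partial_distinguished_matching M"
  shows "partial_distinguished_matching (glue F)"
proof -
  define Q \<phi> where "Q = fst (glue F)" and "\<phi> = snd (glue F)"
  have ex: "\<exists>N \<in> F. u \<in> fst N" if "u \<in> Q" for u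
    using that unfolding Q_def fst_glue by blast
  have sub: "fst N \<subseteq> Q" if "N \<in> F" for N using that unfolding Q_def fst_glue by blast
  have eq: "\<phi> v = snd N v" if "N \<in> F" "v \<in> fst N" for N v
    using glue_apply[OF F that] by (simp add: \<phi>_def)
  have M': "partial_distinguished_matching (fst N, snd N)" if "N \<in> F" for N using M[OF that] by simp
  have "partial_distinguished_matching (Q, \<phi>)"
  proof (rule matchingI)
    show "decreasing Q"
      unfolding decreasing_def
    proof (intro conjI subsetI ballI allI impI)
      fix q assume "q \<in> Q"
      then obtain N where N: "N \<in> F" "q \<in> fst N" using ex by blast
      note dec = matchingD(1)[OF M'[OF N(1)]]
      show "q \<in> carrier W" using decreasing_closed[OF dec N(2)] .
      fix x assume "bruhat_le x q"
      then have "x \<in> fst N" using dec N(2) unfolding decreasing_def by blast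
      then show "x \<in> Q" using sub[OF N(1)] by blast
    qed
    have "\<phi> u \<in> Q" if "u \<in> Q" for u
    proof -
      obtain N where N: "N \<in> F" "u \<in> fst N" using ex[OF \<open>u \<in> Q\<close>] by blast
      then show ?thesis using matchingD(3)[OF M'[OF N(1)] N(2)] sub[OF N(1)] eq[OF N] by auto
    qed
    moreover have "\<phi> \<in> extensional Q" unfolding \<phi>_def Q_def glue_def by simp
    ultimately show "\<phi> \<in> Q \<rightarrow>\<^sub>E Q" by (simp add: PiE_iff)
    fix u assume "u \<in> Q"
    then obtain N where N: "N \<in> F" and u: "u \<in> fst N" using ex by blast
    define \<psi> where "\<psi> = snd N"
    note eq = eq[OF N, folded \<psi>_def]
    note D = matchingD[OF M'[OF N], folded \<psi>_def]
    show "\<phi> (\<phi> u) = u" using eq[OF u] eq[OF D(3)[OF u]] D(4)[OF u] by simp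
    show "covered_by u (\<phi> u) \<or> covered_by (\<phi> u) u" using eq[OF u] D(5)[OF u] by simp
    assume "covered_by u (\<phi> u)"
    then have "coat (\<phi> u) = {u} \<union> {\<psi> v | v. covered_by v u \<and> covered_by v (\<psi> v)}"
      using D(6)[OF u] eq[OF u] by simp
    moreover have "\<phi> v = \<psi> v" if "covered_by v u" for v
      using eq decreasing_covered_by[OF D(1) u that] by simp
    then have "{\<psi> v | v. covered_by v u \<and> covered_by v (\<psi> v)} =
        {\<phi> v | v. covered_by v u \<and> covered_by v (\<phi> v)}" by metis
    ultimately show "coat (\<phi> u) = {u} \<union> {\<phi> v | v. covered_by v u \<and> covered_by v (\<phi> v)}" by simp
  qed
  then show ?thesis by (simp add: Q_def \<phi>_def)
qed

lemma matching_le_antisym: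
  assumes "partial_distinguished_matching M" "partial_distinguished_matching N"
    and "matching_le M N" "matching_le N M"
  shows "M = N"
proof -
  obtain Q \<phi> R \<psi> where M: "M = (Q, \<phi>)" and N: "N = (R, \<psi>)" by (cases M, cases N)
  have "Q = R" and eq: "\<And>u. u \<in> Q \<Longrightarrow> \<phi> u = \<psi> u"
    using assms(3,4) by (auto simp: M N matching_le_def)
  moreover have "\<phi> = \<psi>"
    using matchingD(2)[OF assms(1)[unfolded M]] matchingD(2)[OF assms(2)[unfolded N]] eq \<open>Q = R\<close>
    by (intro PiE_ext) auto
  ultimately show ?thesis by (simp add: M N)
qed

text \<open>Gluing is used twice: for the seeds, which shows that the family \<open>F\<close> of all
  matchings extending them is inhabited, and for \<open>F\<close> itself, whose members agree
  pairwise by \<open>matchings_agree\<close>. Every maximal solution lies in \<open>F\<close>, hence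
  below \<open>glue F\<close>, hence equals it.\<close>

theorem ex1_maximal_matching:
  assumes a: "a \<in> S"
    and \<alpha>: "\<And>s. s \<in> S - {a} \<Longrightarrow> distinguished_matching_on (generate W {s, a}) (\<alpha> s)"
    and \<alpha>_one: "\<And>s. s \<in> S - {a} \<Longrightarrow> \<alpha> s \<one> = a"
  shows "\<exists>!M. maximal_distinguished_matching M \<and>
    (\<forall>s \<in> S - {a}. generate W {s, a} \<subseteq> fst M \<and> restrict (snd M) (generate W {s, a}) = \<alpha> s)"
proof -
  let ?P = "\<lambda>s. generate W {s, a}"
  have \<alpha>M: "partial_distinguished_matching (?P s, \<alpha> s)" if "s \<in> S - {a}" for s
    using \<alpha>[OF that] by (simp add: distinguished_matching_on_def)
  have one: "\<one> \<in> ?P s" for s by (rule generate.one)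
  \<comment> \<open>The value at \<open>\<one>\<close> is required separately because for
    \<open>S = {a}\<close> the conditions on the \<open>\<alpha> s\<close> are vacuous.\<close>
  define F where "F = {M. partial_distinguished_matching M \<and> \<one> \<in> fst M \<and> snd M \<one> = a \<and>
    (\<forall>s \<in> S - {a}. ?P s \<subseteq> fst M \<and> (\<forall>u \<in> ?P s. snd M u = \<alpha> s u))}"
  have restrict_iff: "restrict \<phi> (?P s) = \<alpha> s \<longleftrightarrow> (\<forall>u \<in> ?P s. \<phi> u = \<alpha> s u)" if "s \<in> S - {a}" for \<phi> s
  proof
    assume "restrict \<phi> (?P s) = \<alpha> s"
    then show "\<forall>u \<in> ?P s. \<phi> u = \<alpha> s u" by (metis restrict_apply')
  next
    assume "\<forall>u \<in> ?P s. \<phi> u = \<alpha> s u"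
    then show "restrict \<phi> (?P s) = \<alpha> s"
      using matchingD(2)[OF \<alpha>M[OF that]] by (intro extensionalityI[of _ "?P s"]) (auto simp: PiE_iff)
  qed
  have F_compatible: "compatible F"
    unfolding compatible_def
  proof (intro ballI)
    fix M N x assume MN: "M \<in> F" "N \<in> F" and x: "x \<in> fst M \<inter> fst N"
    show "snd M x = snd N x"
      by (rule matchings_agree[of "fst M" "snd M" "fst N" "snd N" a]) (use MN x a in \<open>auto simp: F_def\<close>)
  qed
  have F_up: "N \<in> F" if "M \<in> F" "matching_le M N" "partial_distinguished_matching N" for M N
    using that unfolding F_def matching_le_def by (auto simp: subset_iff)
  define F0 where "F0 = insert (gen_matching a) ((\<lambda>s. (?P s, \<alpha> s)) ` (S - {a}))"
  have F0M: "partial_distinguished_matching M" if "M \<in> F0" for M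
    using that \<alpha>M gen_matching[OF a] by (auto simp: F0_def)
  have F0_a: "snd M \<one> = a \<and> snd M a = \<one>" if "M \<in> F0" for M
  proof -
    have "\<one> \<in> fst M \<and> snd M \<one> = a"
      using that \<alpha>_one one gen_neq_one[OF a] by (auto simp: F0_def gen_matching_def)
    then show ?thesis using matchingD(4)[of "fst M" "snd M" \<one>] F0M[OF that] by simp
  qed
  \<comment> \<open>Two different dihedral subgroups through \<open>a\<close> meet in the subgroup
    generated by \<open>a\<close> alone, and on \<open>{\<one>, a}\<close> all seeds agree by
    \<open>F0_a\<close>.\<close>
  have F0_Int: "x \<in> {\<one>, a} \<or> M = N" 
    if MN: "M \<in> F0" "N \<in> F0" "x \<in> fst M" "x \<in> fst N" for M N x
  proof (rule ccontr)
    assume no: "\<not> ?thesis"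
    have "\<exists>s \<in> S - {a}. K = (?P s, \<alpha> s)" if "K \<in> F0" "x \<in> fst K" for K
      using that no by (auto simp: F0_def gen_matching_def)
    then obtain s t where "s \<in> S - {a}" "M = (?P s, \<alpha> s)" "t \<in> S - {a}" "N = (?P t, \<alpha> t)"
      using MN by meson
    then have st: "s \<in> S - {a}" "t \<in> S - {a}" "s \<noteq> t" "x \<in> ?P s" "x \<in> ?P t"
      using MN no by auto
    have "x \<in> generate W ({s, a} \<inter> {t, a})" using generate_Int[of "{s, a}" "{t, a}"] st a by auto
    moreover have "{s, a} \<inter> {t, a} = {a}" using st by auto
    ultimately show False using no generate_gen[OF a] by simp
  qed
  have F0_compatible: "compatible F0"
    unfolding compatible_def using F0_a F0_Int by (metis Int_iff insertE singletonD)
  have "glue F0 \<in> F"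
  proof -
    have g: "gen_matching a \<in> F0" by (simp add: F0_def)
    have "\<one> \<in> fst (gen_matching a)" by (simp add: gen_matching_def)
    then have "\<one> \<in> fst (glue F0)" "snd (glue F0) \<one> = a"
      using matching_le_glue[OF F0_compatible g] F0_a[OF g] by (auto simp: matching_le_def)
    moreover have "?P s \<subseteq> fst (glue F0) \<and> (\<forall>u \<in> ?P s. snd (glue F0) u = \<alpha> s u)" if "s \<in> S - {a}" for s
    proof -
      have "(?P s, \<alpha> s) \<in> F0" using that by (auto simp: F0_def)
      then show ?thesis using matching_le_glue[OF F0_compatible] by (fastforce simp: matching_le_def)
    qed
    ultimately show ?thesis using matching_glue[OF F0_compatible F0M] by (simp add: F_def)
  qed
  moreover have gM: "partial_distinguished_matching (glue F)"
    using F_compatible by (rule matching_glue) (simp add: F_def)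
  ultimately have gF: "glue F \<in> F" using F_up matching_le_glue[OF F_compatible] by blast
  \<comment> \<open>A matching above \<open>glue F\<close> is itself in \<open>F\<close> by
    \<open>F_up\<close>, hence also below \<open>glue F\<close>.\<close>
  have max: "maximal_distinguished_matching (glue F)"
    unfolding maximal_distinguished_matching_def
    using gM gF F_up matching_le_antisym matching_le_glue[OF F_compatible] by blast
  show ?thesis
  proof (rule ex1I[of _ "glue F"])
    show "maximal_distinguished_matching (glue F) \<and>
      (\<forall>s \<in> S - {a}. ?P s \<subseteq> fst (glue F) \<and> restrict (snd (glue F)) (?P s) = \<alpha> s)"
      using max gF restrict_iff by (simp add: F_def)
  next
    fix M assume M: "maximal_distinguished_matching M \<and>
      (\<forall>s \<in> S - {a}. ?P s \<subseteq> fst M \<and> restrict (snd M) (?P s) = \<alpha> s)"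
    then have max: "maximal_distinguished_matching (fst M, snd M)" by simp
    note pM = maximal_matchingD[OF max]
    have oneM: "\<one> \<in> fst M" using maximal_matching_one[OF max] a by blast
    \<comment> \<open>If \<open>\<one>\<close> were matched with another generator \<open>b\<close>,
      the requirement on the subgroup of \<open>b\<close> and \<open>a\<close> would give
      \<open>\<alpha> b \<one> = b\<close>, against \<open>\<alpha> b \<one> = a\<close>. For
      \<open>S = {a}\<close> there is no such \<open>b\<close>.\<close>
    have "snd M \<one> = a"
    proof (rule ccontr)
      assume neq: "snd M \<one> \<noteq> a"
      then have s: "snd M \<one> \<in> S - {a}" using matching_one_gen[OF pM oneM] by simp
      then have "snd M \<one> = \<alpha> (snd M \<one>) \<one>" using M restrict_iff[OF s] one by blast
      then show False using \<alpha>_one[OF s] neq by simp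
    qed
    then have "M \<in> F" using M oneM restrict_iff maximal_matchingD by (simp add: F_def)
    then show "M = glue F"
      using M gM matching_le_glue[OF F_compatible] unfolding maximal_distinguished_matching_def by metis
  qed
qed

end

theorem mainTheorem4:
  fixes W :: "('a, 'b) monoid_scheme" and S :: "'a set"
  assumes "coxeter_system W S"
  shows
    "(\<forall>Q \<phi> a. coxeter_system.maximal_distinguished_matching W S (Q, \<phi>) \<and> a = \<phi> \<one>\<^bsub>W\<^esub> \<longrightarrow>
        (S \<noteq> {} \<longrightarrow> \<one>\<^bsub>W\<^esub> \<in> Q \<and> a \<in> S) \<and>
        (\<forall>s \<in> S - {a}.
           generate W {s, a} \<subseteq> Q \<and>
           \<phi> ` generate W {s, a} \<subseteq> generate W {s, a} \<and>
           coxeter_system.distinguished_matching_on W S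
             (generate W {s, a}) (restrict \<phi> (generate W {s, a}))))
     \<and>
     (\<forall>a \<in> S. \<forall>\<alpha>.
        (\<forall>s \<in> S - {a}.
           coxeter_system.distinguished_matching_on W S (generate W {s, a}) (\<alpha> s) \<and>
           \<alpha> s \<one>\<^bsub>W\<^esub> = a) \<longrightarrow>
        (\<exists>!M. coxeter_system.maximal_distinguished_matching W S M \<and>
           (\<forall>s \<in> S - {a}.
              generate W {s, a} \<subseteq> fst M \<and>
              restrict (snd M) (generate W {s, a}) = \<alpha> s)))"
proof -
  interpret coxeter_system W S by (rule assms)
  show ?thesis
  proof (intro conjI allI impI ballI)
    fix Q \<phi> a
    assume A: "maximal_distinguished_matching (Q, \<phi>) \<and> a = \<phi> \<one>\<^bsub>W\<^esub>"
    then have max: "maximal_distinguished_matching (Q, \<phi>)" and a: "a = \<phi> \<one>\<^bsub>W\<^esub>" by simp_all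
    show one: "\<one>\<^bsub>W\<^esub> \<in> Q" if "S \<noteq> {}" using maximal_matching_one[OF max that] .
    show "a \<in> S" if "S \<noteq> {}"
      unfolding a by (rule matching_one_gen(2)[OF maximal_matchingD[OF max] one[OF that]])
    fix s assume "s \<in> S - {a}"
    then have s: "s \<in> S" by simp
    note P = maximal_matching_restrict_dihedral[OF max a s]
    show "generate W {s, a} \<subseteq> Q" by (rule P)
    show "\<phi> ` generate W {s, a} \<subseteq> generate W {s, a}" by (rule P)
    show "distinguished_matching_on (generate W {s, a}) (restrict \<phi> (generate W {s, a}))" by (rule P)
  next
    fix a \<alpha>
    assume a: "a \<in> S"
      and "\<forall>s \<in> S - {a}. distinguished_matching_on (generate W {s, a}) (\<alpha> s) \<and> \<alpha> s \<one>\<^bsub>W\<^esub> = a"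
    then show "\<exists>!M. maximal_distinguished_matching M \<and>
        (\<forall>s \<in> S - {a}. generate W {s, a} \<subseteq> fst M \<and> restrict (snd M) (generate W {s, a}) = \<alpha> s)"
      by (intro ex1_maximal_matching) simp_all
  qed
qed

end
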